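(* There is no planar graph $G$ satisfying any of the following: (i) $d(G) \geq 4$ and $e(v) = 0$ for all vertices $v$; (ii) $d(G) = 5$ and there is $c \in \{1,2,3\}$ such that $e(v) = c$ for all vertices $v$; (iii) $d(G) \leq 5$ and $e(v) = 6$ for all vertices $v$.
   Context: All graphs are finite, simple and have at least one vertex. $d(G)$ denotes the average degree of $G$, i.e. $2|E(G)|/|V(G)|$. For a vertex $v$, $e(v)$ denotes the number of edges of the subgraph of $G$ induced by the open neighbourhood $N(v)$ of $v$. *)

theory Defs
  imports "HOL-Analysis.Analysis"
begin

text \<open>A finite simple graph is given by its vertex set \<open>V\<close> and its edge set \<open>E\<close>,
  a set of two-element subsets of \<open>V\<close>.\<close>

definition simple_graph :: "'a set \<Rightarrow> 'a set set \<Rightarrow> bool" where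
  "simple_graph V E \<longleftrightarrow> finite V \<and> V \<noteq> {} \<and> (\<forall>e\<in>E. e \<subseteq> V \<and> card e = 2)"

definition neighbourhood :: "'a set set \<Rightarrow> 'a \<Rightarrow> 'a set" where
  "neighbourhood E v = {u. {u, v} \<in> E}"

definition induced_edges :: "'a set set \<Rightarrow> 'a set \<Rightarrow> 'a set set" where
  "induced_edges E S = {e \<in> E. e \<subseteq> S}"

definition nbhd_edge_count :: "'a set set \<Rightarrow> 'a \<Rightarrow> nat" where
  "nbhd_edge_count E v = card (induced_edges E (neighbourhood E v))"

definition average_degree :: "'a set \<Rightarrow> 'a set set \<Rightarrow> real" where
  "average_degree V E = 2 * real (card E) / real (card V)"

text \<open>A plane drawing, with \<open>complex\<close> as the Euclidean plane: distinct vertices go to distinct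
  points \<open>p v\<close>; an edge \<open>e\<close> goes to a simple arc \<open>\<gamma> e\<close> (in either orientation) joining the images
  of its ends and meeting no other vertex; distinct edges meet only in common ends.\<close>

definition plane_drawing ::
  "'a set \<Rightarrow> 'a set set \<Rightarrow> ('a \<Rightarrow> complex) \<Rightarrow> ('a set \<Rightarrow> real \<Rightarrow> complex) \<Rightarrow> bool" where
  "plane_drawing V E p \<gamma> \<longleftrightarrow>
     inj_on p V \<and>
     (\<forall>e\<in>E. arc (\<gamma> e) \<and> {pathstart (\<gamma> e), pathfinish (\<gamma> e)} = p ` e \<and>
        path_image (\<gamma> e) \<inter> p ` V = p ` e) \<and>
     (\<forall>e\<in>E. \<forall>f\<in>E. e \<noteq> f \<longrightarrow> path_image (\<gamma> e) \<inter> path_image (\<gamma> f) = p ` (e \<inter> f))"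

definition planar :: "'a set \<Rightarrow> 'a set set \<Rightarrow> bool" where
  "planar V E \<longleftrightarrow> (\<exists>p \<gamma>. plane_drawing V E p \<gamma>)"

end

theory Submission
  imports Defs
begin

text \<open>A subgraph built from a cycle by adding ears has $m - n + 1$ bounded faces, each bounded by a
  cycle, and each edge lies on exactly two of the boundary cycles (the outer one included). As every
  boundary cycle of length three is a triangle of the graph, counting edges gives $2m + 7 \le 4n + t$
  and $m + 6 \le 3n$ for such subgraphs, where $t$ is the number of triangles. In a maximal
  such subgraph (a single edge if there is no cycle) each part of the rest of the graph is attached at
  one vertex at most, so induction over separations of order at most one yields $2m + 4 \le 4n + t$,
  and $m + 6 \le 3n$ for $n \ge 3$, for every planar graph. Since $3t = \sum_v e(v)$, this excludes
  (i) and (ii).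

  For (iii), $e(v) = 6$ forces $\deg v \ge 5$, as $K_5$ violates $m + 6 \le 3n$. On the other hand, let
  $T$ be a triangle with the fewest, but some, vertices inside, and $w$ a vertex inside $T$. No triangle
  through $w$ has a vertex inside, so each edge at $w$ lies in at most two triangles, whence
  $e(w) \le \deg w$. (If there is no such $T$, any $w$ will do.) So $\deg w \ge 6$ and $d(G) > 5$.\<close>

subsection \<open>Arcs and theta curves in the plane\<close>

text \<open>The obstacle is Euler's formula for a topological drawing. In general a face boundary
  need not be a cycle, so face lengths are awkward even to state. For a graph grown from a cycle by
  ears every boundary is a cycle, and an ear affects a single face, by an argument on theta curves.
  Hence the restriction to such subgraphs and the separate treatment of cut vertices. The constants:
  with f = m - n + 1 bounded faces, all of length at least 4 except for triangles, and the outer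
  boundary counted only as 3, one gets 4f + 3 \<le> 2m + t, that is 2m + 7 \<le> 4n + t. The outer
  boundary gets no triangle of its own since it may coincide with a bounded one. The constant drops
  to 4 because this value is stable under gluing at a vertex: 4 + 4 on the left against 4 for the
  vertex counted twice on the right. What remains, 2m < 4n + t, is just enough for c = 3 in (ii),
  where t = n and 2m = 5n.\<close>

definition arc_between :: "complex \<Rightarrow> complex \<Rightarrow> complex set \<Rightarrow> bool" where
  "arc_between a b A \<longleftrightarrow> (\<exists>g. arc g \<and> pathstart g = a \<and> pathfinish g = b \<and> path_image g = A)"

lemma arc_between_sym: "arc_between a b A \<Longrightarrow> arc_between b a A"
  unfolding arc_between_def
  by (metis arc_reversepath path_image_reversepath pathfinish_reversepath pathstart_reversepath)

lemma arc_between_join: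
  assumes "arc_between a b A" "arc_between b c B" "A \<inter> B = {b}"
  shows "arc_between a c (A \<union> B)"
proof -
  obtain g h where "arc g" "pathstart g = a" "pathfinish g = b" "path_image g = A"
    "arc h" "pathstart h = b" "pathfinish h = c" "path_image h = B"
    using assms(1,2) unfolding arc_between_def by blast
  then have "arc (g +++ h)" "pathstart (g +++ h) = a" "pathfinish (g +++ h) = c"
    "path_image (g +++ h) = A \<union> B"
    using assms(3) by (auto simp: arc_join path_image_join)
  then show ?thesis
    unfolding arc_between_def by blast
qed

text \<open>The closure fact comes from continuity on [0,1], whose interior is dense in it. It later
  transfers information from an open arc, which avoids a given curve, to its ends, which may lie on
  that curve.\<close>

lemma arc_betweenD:
  assumes "arc_between a b A"
  shows "a \<in> A" "b \<in> A" "a \<noteq> b" "compact A" "connected A"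
    "A - {a, b} \<noteq> {}" "connected (A - {a, b})" "closure (A - {a, b}) = A"
proof -
  obtain g where g: "arc g" "pathstart g = a" "pathfinish g = b" "path_image g = A"
    using assms unfolding arc_between_def by blast
  show "a \<in> A" "b \<in> A"
    using g by auto
  show "a \<noteq> b"
    using g arc_distinct_ends by blast
  show "compact A" "connected A"
    using g by (auto simp: compact_arc_image connected_path_image arc_imp_path)
  have sp: "simple_path g"
    using g by (simp add: arc_imp_simple_path)
  show "A - {a, b} \<noteq> {}" "connected (A - {a, b})"
    using nonempty_simple_path_endless[OF sp] connected_simple_path_endless[OF sp] g by auto
  have "A - {a, b} = g ` {0<..<1}"
    using simple_path_endless[OF sp] g by auto
  moreover have "continuous_on (closure {0<..<1}) g"
    using arc_imp_path[OF g(1)] by (simp add: path_def)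
  then have "g ` closure {0<..<1} \<subseteq> closure (g ` {0<..<1})"
    by (intro image_closure_subset) (auto intro: closure_subset[THEN subsetD])
  ultimately have "A \<subseteq> closure (A - {a, b})"
    using g(4) by (simp add: path_image_def)
  moreover have "closure (A - {a, b}) \<subseteq> A"
    using \<open>compact A\<close> by (simp add: closure_minimal compact_imp_closed)
  ultimately show "closure (A - {a, b}) = A"
    by blast
qed

section \<open>Jordan curves and theta curves\<close>

definition closed_curve :: "complex set \<Rightarrow> bool" where
  "closed_curve K \<longleftrightarrow> (\<exists>g. simple_path g \<and> pathfinish g = pathstart g \<and> path_image g = K)"

lemma closed_curve_Un:
  assumes "arc_between a b A" "arc_between a b B" "A \<inter> B = {a, b}"
  shows "closed_curve (A \<union> B)"
proof -
  have "arc_between b a B"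
    using assms(2) by (rule arc_between_sym)
  then obtain g h where "arc g" "pathstart g = a" "pathfinish g = b" "path_image g = A"
    "arc h" "pathstart h = b" "pathfinish h = a" "path_image h = B"
    using assms(1) unfolding arc_between_def by blast
  then have "simple_path (g +++ h)" "pathfinish (g +++ h) = pathstart (g +++ h)"
    "path_image (g +++ h) = A \<union> B"
    using assms(3) by (auto simp: simple_path_join_loop_eq path_image_join)
  then show ?thesis
    unfolding closed_curve_def by blast
qed

lemma closed_curveD:
  assumes "closed_curve K"
  shows "closed K" "bounded K" "inside K \<noteq> {}" "open (inside K)" "connected (inside K)"
    "frontier (inside K) = K" "open (outside K)" "connected (outside K)" "\<not> bounded (outside K)"
    "frontier (outside K) = K" "bounded (inside K)"
proof -
  obtain g where g: "simple_path g" "pathfinish g = pathstart g" "path_image g = K"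
    using assms unfolding closed_curve_def by blast
  show "closed K" "bounded K"
    using g by (auto simp: closed_simple_path_image bounded_simple_path_image)
  show "inside K \<noteq> {}" "open (inside K)" "connected (inside K)"
    "frontier (inside K) = K" "open (outside K)" "connected (outside K)" "\<not> bounded (outside K)"
    "frontier (outside K) = K" "bounded (inside K)"
    using Jordan_inside_outside[OF g(1,2)] g(3) by auto
qed

lemma inside_Un_disjoint: "inside (A \<union> B) \<inter> A = {}" "inside (A \<union> B) \<inter> B = {}"
  using inside_no_overlap[of "A \<union> B"] by blast+

lemma connected_subset_inside:
  assumes "connected S" "S \<inter> K = {}" "S \<inter> inside K \<noteq> {}"
  shows "S \<subseteq> inside K"
proof -
  have "S \<inter> outside K = {}"
    using inside_outside_intersect_connected[of S K] assms by blast
  then show ?thesis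
    using assms(2) inside_Un_outside[of K] by blast
qed

lemma connected_subset_outside:
  assumes "connected S" "S \<inter> K = {}" "S \<inter> outside K \<noteq> {}"
  shows "S \<subseteq> outside K"
proof -
  have "S \<inter> inside K = {}"
    using inside_outside_intersect_connected[of S K] assms by blast
  then show ?thesis
    using assms(2) inside_Un_outside[of K] by blast
qed

text \<open>In a theta curve the arc that enters the inside of the other two is a chord of that
  Jordan curve and cuts its inside in two. The last assumption says that \<open>C\<close> is this
  middle arc.\<close>

lemma theta_split:
  assumes "arc_between a b A" "arc_between a b B" "arc_between a b C"
    and "A \<inter> B = {a, b}" "A \<inter> C = {a, b}" "B \<inter> C = {a, b}"
    and "C \<inter> inside (A \<union> B) \<noteq> {}"
  shows "inside (A \<union> C) \<inter> inside (B \<union> C) = {}"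
    and "inside (A \<union> C) \<union> inside (B \<union> C) \<union> (C - {a, b}) = inside (A \<union> B)"
proof -
  obtain f where f: "arc f" "pathstart f = a" "pathfinish f = b" "path_image f = A"
    using assms unfolding arc_between_def by blast
  obtain g where g: "arc g" "pathstart g = a" "pathfinish g = b" "path_image g = B"
    using assms unfolding arc_between_def by blast
  obtain h where h: "arc h" "pathstart h = a" "pathfinish h = b" "path_image h = C"
    using assms unfolding arc_between_def by blast
  have "a \<noteq> b"
    using arc_betweenD(3) assms(1) by blast
  have "inside (A \<union> C) \<inter> inside (B \<union> C) = {} \<and>
    inside (A \<union> C) \<union> inside (B \<union> C) \<union> (C - {a, b}) = inside (A \<union> B)"
    by (rule split_inside_simple_closed_curve[of f a b g h])
      (use assms f g h \<open>a \<noteq> b\<close> in \<open>auto intro: arc_imp_simple_path\<close>)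
  then show "inside (A \<union> C) \<inter> inside (B \<union> C) = {}"
    "inside (A \<union> C) \<union> inside (B \<union> C) \<union> (C - {a, b}) = inside (A \<union> B)"
    by blast+
qed

text \<open>Otherwise a point inside \<open>A \<union> B\<close> lies outside both \<open>A \<union> C\<close> and \<open>B \<union> C\<close>, which share the
  connected set \<open>C\<close>; by Janiszewski's theorem it then lies outside \<open>A \<union> B \<union> C\<close>.\<close>

lemma theta_middle:
  assumes A: "arc_between a b A" and B: "arc_between a b B" and C: "arc_between a b C"
    and AB: "A \<inter> B = {a, b}" and AC: "A \<inter> C = {a, b}" and BC: "B \<inter> C = {a, b}"
  shows "C \<inter> inside (A \<union> B) \<noteq> {} \<or> A \<inter> inside (B \<union> C) \<noteq> {} \<or> B \<inter> inside (A \<union> C) \<noteq> {}"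
proof (rule ccontr)
  assume "\<not> ?thesis"
  then have nC: "C \<inter> inside (A \<union> B) = {}" and nA: "A \<inter> inside (B \<union> C) = {}"
    and nB: "B \<inter> inside (A \<union> C) = {}"
    by auto
  note cAB = closed_curve_Un[OF A B AB]
  note cAC = closed_curve_Un[OF A C AC]
  note cBC = closed_curve_Un[OF B C BC]
  \<comment> \<open>If the two insides met, the first, being connected and disjoint from
    \<open>X \<union> Z\<close>, would lie in the second. Passing to closures, \<open>Y\<close>
    would lie in \<open>(X \<union> Z) \<union> inside (X \<union> Z)\<close>, which the assumptions
    on \<open>Y\<close> forbid.\<close>
  have out: "inside (X \<union> Y) \<subseteq> outside (X \<union> Z)"
    if cXY: "closed_curve (X \<union> Y)" and cXZ: "closed_curve (X \<union> Z)" and Z: "Z \<inter> inside (X \<union> Y) = {}"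
      and Y: "Y \<inter> inside (X \<union> Z) = {}" "\<not> Y \<subseteq> X \<union> Z" for X Y Z
  proof (rule ccontr)
    assume "\<not> inside (X \<union> Y) \<subseteq> outside (X \<union> Z)"
    moreover have dis: "inside (X \<union> Y) \<inter> (X \<union> Z) = {}"
      using Z inside_no_overlap[of "X \<union> Y"] by blast
    ultimately have "inside (X \<union> Y) \<inter> inside (X \<union> Z) \<noteq> {}"
      using inside_Un_outside[of "X \<union> Z"] by blast
    then have "inside (X \<union> Y) \<subseteq> inside (X \<union> Z)"
      using connected_subset_inside closed_curveD(5)[OF cXY] dis by blast
    then have "closure (inside (X \<union> Y)) \<subseteq> closure (inside (X \<union> Z))"
      by (rule closure_mono)
    moreover have "X \<union> Y \<subseteq> closure (inside (X \<union> Y))"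
      using closed_curveD(6)[OF cXY] by (auto simp: frontier_def)
    moreover have "closure (inside (X \<union> Z)) \<subseteq> (X \<union> Z) \<union> inside (X \<union> Z)"
      by (rule closure_inside_subset) (rule closed_curveD(1)[OF cXZ])
    ultimately show False
      using Y by blast
  qed
  have nsub: "\<not> B \<subseteq> A \<union> C" "\<not> A \<subseteq> B \<union> C"
    using arc_betweenD(6)[OF A] arc_betweenD(6)[OF B] AB AC BC by blast+
  have "inside (A \<union> B) \<subseteq> outside (A \<union> C)"
    by (rule out) (use cAB cAC nC nB nsub in auto)
  moreover have "inside (B \<union> A) \<subseteq> outside (B \<union> C)"
    by (rule out) (use cAB cBC nC nA nsub in \<open>auto simp: Un_commute\<close>)
  moreover obtain u where u: "u \<in> inside (A \<union> B)"
    using closed_curveD(3)[OF cAB] by blast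
  ultimately have uo: "u \<in> outside (A \<union> C)" "u \<in> outside (B \<union> C)"
    by (auto simp: Un_commute)
  \<comment> \<open>A far point \<open>v\<close>, outside all three curves at once, serves as the
    second point for Janiszewski's theorem.\<close>
  have "bounded (A \<union> B \<union> C)"
    using closed_curveD(2)[OF cAB] closed_curveD(2)[OF cAC] by auto
  then have "\<not> bounded (outside (A \<union> B \<union> C))"
    by (intro unbounded_outside) auto
  then obtain v where v: "v \<in> outside (A \<union> B \<union> C)"
    by (metis bounded_empty equals0I)
  have vo: "v \<in> outside (A \<union> C)" "v \<in> outside (B \<union> C)" "v \<in> outside (A \<union> B)"
    by (rule subsetD[OF outside_mono v]; blast)+
  have cc: "connected_component (- K) u v"
    if "closed_curve K" "u \<in> outside K" "v \<in> outside K" for K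
    using that(2,3) closed_curveD(8)[OF that(1)] outside_no_overlap[of K]
    unfolding connected_component_def by (intro exI[of _ "outside K"]) blast
  have "(A \<union> C) \<inter> (B \<union> C) = C"
    using AB AC BC by blast
  then have "connected_component (- ((A \<union> C) \<union> (B \<union> C))) u v"
    using cc[OF cAC] cc[OF cBC] uo vo closed_curveD(1,2)[OF cAC] closed_curveD(1)[OF cBC]
      arc_betweenD(5)[OF C]
    by (intro Janiszewski[of "A \<union> C" "B \<union> C"]) (simp_all add: compact_eq_bounded_closed)
  then obtain T where "connected T" "T \<subseteq> - (A \<union> B)" "u \<in> T" "v \<in> T"
    unfolding connected_component_def by blast
  then show False
    using inside_outside_intersect_connected[of T "A \<union> B"] u vo(3) by blast
qed

text \<open>Otherwise \<open>e\<close> lies inside each of \<open>A \<union> B\<close>, \<open>A \<union> C\<close> and \<open>B \<union> C\<close>, while the middle one of the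
  arcs \<open>A\<close>, \<open>B\<close>, \<open>C\<close> bounds two disjoint regions with the other two.\<close>

lemma four_arcs:
  assumes e: "arc_between a b e"
    and A: "arc_between a b A" and B: "arc_between a b B" and C: "arc_between a b C"
    and i: "A \<inter> B = {a, b}" "A \<inter> C = {a, b}" "B \<inter> C = {a, b}"
    and ie: "e \<inter> A = {a, b}" "e \<inter> B = {a, b}" "e \<inter> C = {a, b}"
  shows "\<exists>X\<in>{A, B, C}. \<exists>Y\<in>{A, B, C}. X \<noteq> Y \<and> X \<inter> inside (e \<union> Y) \<noteq> {}"
proof (rule ccontr)
  assume "\<not> ?thesis"
  then have *: "X \<inter> inside (e \<union> Y) = {}" if "X \<in> {A, B, C}" "Y \<in> {A, B, C}" "X \<noteq> Y" for X Y
    using that by blast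
  note i' = i[THEN trans[OF Int_commute]]
    ie[THEN trans[OF Int_commute]]
  have ne: "A \<noteq> B" "A \<noteq> C" "B \<noteq> C"
    using i arc_betweenD(6)[OF A] arc_betweenD(6)[OF B] arc_betweenD(6)[OF C] by auto
  \<comment> \<open>Neither \<open>X\<close> nor \<open>Y\<close> is the middle arc of the theta
    curve formed by \<open>X\<close>, \<open>Y\<close> and \<open>e\<close>, so \<open>e\<close>
    is.\<close>
  have sep: "e - {a, b} \<subseteq> inside (X \<union> Y)"
    if "X \<in> {A, B, C}" "Y \<in> {A, B, C}" "X \<noteq> Y" for X Y
  proof -
    have XY: "arc_between a b X" "arc_between a b Y" "X \<inter> Y = {a, b}" "X \<inter> e = {a, b}"
      "Y \<inter> e = {a, b}"
      using that A B C i i' by (elim insertE emptyE; simp)+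
    have "X \<inter> inside (Y \<union> e) = {}" "Y \<inter> inside (X \<union> e) = {}"
      using *[of X Y] *[of Y X] that by (simp_all add: Un_commute)
    then have "e \<inter> inside (X \<union> Y) \<noteq> {}"
      using theta_middle[OF XY(1,2) e XY(3-5)] by blast
    moreover have "a \<notin> inside (X \<union> Y)" "b \<notin> inside (X \<union> Y)"
      using inside_no_overlap[of "X \<union> Y"] arc_betweenD(1,2)[OF XY(1)] by blast+
    ultimately show ?thesis
      using connected_subset_inside[OF arc_betweenD(7)[OF e], of "X \<union> Y"] XY by blast
  qed
  have e0: "e - {a, b} \<noteq> {}"
    by (rule arc_betweenD(6)[OF e])
  \<comment> \<open>If \<open>Z\<close> were the middle arc, the insides of
    \<open>X \<union> Z\<close> and \<open>Y \<union> Z\<close> would be disjoint, but both contain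
    the open arc \<open>e\<close>.\<close>
  have no: "Z \<inter> inside (X \<union> Y) = {}"
    if "arc_between a b X" "arc_between a b Y" "arc_between a b Z" "X \<inter> Y = {a, b}"
      "X \<inter> Z = {a, b}" "Y \<inter> Z = {a, b}"
      and "e - {a, b} \<subseteq> inside (X \<union> Z)" "e - {a, b} \<subseteq> inside (Y \<union> Z)" for X Y Z
    using theta_split(1)[OF that(1-6)] that(7,8) e0 by blast
  have "e - {a, b} \<subseteq> inside (A \<union> B)" "e - {a, b} \<subseteq> inside (A \<union> C)" "e - {a, b} \<subseteq> inside (B \<union> C)"
    "e - {a, b} \<subseteq> inside (B \<union> A)" "e - {a, b} \<subseteq> inside (C \<union> A)" "e - {a, b} \<subseteq> inside (C \<union> B)"
    using ne by (intro sep; simp)+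
  then have "C \<inter> inside (A \<union> B) = {}" "A \<inter> inside (B \<union> C) = {}" "B \<inter> inside (A \<union> C) = {}"
    using no[OF A B C i] no[OF B C A i(3) i'(1,2)] no[OF A C B i(2,1) i'(3)] by simp_all
  then show False
    using theta_middle[OF A B C i] by simp
qed

subsection \<open>Paths and cycles as edge sets\<close>

text \<open>A path is kept as its set of edges, without order, because the drawing and all counts
  depend on that set only. It has at least one edge, so its ends differ; the side condition of
  \<open>step\<close> keeps vertices from repeating.\<close>

inductive upath :: "'a \<Rightarrow> 'a \<Rightarrow> 'a set set \<Rightarrow> bool" where
  edge: "x \<noteq> y \<Longrightarrow> upath x y {{x, y}}"
| step: "upath y z P \<Longrightarrow> x \<notin> \<Union>P \<Longrightarrow> upath x z (insert {x, y} P)"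

lemma upathD:
  assumes "upath x y P"
  shows "x \<in> \<Union>P" "y \<in> \<Union>P" "x \<noteq> y" "finite P" "finite (\<Union>P)" "card (\<Union>P) = card P + 1"
    "\<forall>e\<in>P. card e = 2"
proof -
  have "x \<in> \<Union>P \<and> y \<in> \<Union>P \<and> x \<noteq> y \<and> finite P \<and> finite (\<Union>P) \<and> card (\<Union>P) = card P + 1 \<and>
    (\<forall>e\<in>P. card e = 2)"
    using assms
  proof induction
    case (edge x y)
    then show ?case by simp
  next
    case (step y z P x)
    have "x \<noteq> y"
      using step.hyps(2) step.IH by blast
    moreover have "{x, y} \<notin> P"
      using step.hyps(2) by blast
    moreover have "\<Union>(insert {x, y} P) = insert x (\<Union>P)"
      using step.IH by blast
    ultimately show ?case
      using step by auto
  qed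
  then show "x \<in> \<Union>P" "y \<in> \<Union>P" "x \<noteq> y" "finite P" "finite (\<Union>P)" "card (\<Union>P) = card P + 1"
    "\<forall>e\<in>P. card e = 2" by blast+
qed

lemma upath_nonempty: "upath x y P \<Longrightarrow> P \<noteq> {}"
  using upathD(1) by fastforce

lemma upath_trans:
  assumes "upath x y P" "upath y z Q" "\<Union>P \<inter> \<Union>Q = {y}"
  shows "upath x z (P \<union> Q)"
  using assms
proof (induction)
  case (edge x y)
  then have "x \<notin> \<Union>Q"
    by auto
  then show ?case
    using upath.step[OF edge(2)] by simp
next
  case (step y' y P x)
  have y: "y \<in> \<Union>P" "y \<in> \<Union>Q"
    using upathD(2)[OF step.hyps(1)] upathD(1)[OF step.prems(1)] by simp_all
  then have "\<Union>P \<inter> \<Union>Q = {y}"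
    using step.prems(2) by blast
  then have "upath y' z (P \<union> Q)"
    using step by blast
  moreover have "x \<notin> \<Union>(P \<union> Q)"
    using step.hyps(2) step.prems(2) y by auto
  ultimately show ?case
    using upath.step by fastforce
qed

lemma upath_sym: "upath x y P \<Longrightarrow> upath y x P"
proof (induction rule: upath.induct)
  case (edge x y)
  then show ?case
    using upath.edge[of y x] by (simp add: insert_commute)
next
  case (step y z P x)
  have "x \<noteq> y"
    using step.hyps(2) upathD(1)[OF step.hyps(1)] by blast
  then have "upath y x {{x, y}}"
    using upath.edge[of y x] by (simp add: insert_commute)
  moreover have "\<Union>P \<inter> \<Union>{{x, y}} = {y}"
    using step.hyps(2) upathD(1)[OF step.hyps(1)] by auto
  ultimately have "upath z x (P \<union> {{x, y}})"
    by (rule upath_trans[OF step.IH])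
  then show ?case
    by simp
qed

lemma edge_sets_disjoint:
  assumes "\<forall>e\<in>P. card e = 2" "\<Union>P \<inter> \<Union>Q \<subseteq> {y}"
  shows "P \<inter> Q = {}"
proof (rule ccontr)
  assume "P \<inter> Q \<noteq> {}"
  then obtain e where "e \<in> P" "e \<in> Q"
    by blast
  then have "e \<subseteq> {y}" "card e = 2"
    using assms by blast+
  then show False
    using card_mono[of "{y}" e] by simp
qed

lemma upath_split:
  assumes "upath x z P" "y \<in> \<Union>P" "y \<noteq> x" "y \<noteq> z"
  obtains P1 P2 where "upath x y P1" "upath y z P2" "\<Union>P1 \<inter> \<Union>P2 = {y}" "P = P1 \<union> P2" "P1 \<inter> P2 = {}"
proof -
  have "\<exists>P1 P2. upath x y P1 \<and> upath y z P2 \<and> \<Union>P1 \<inter> \<Union>P2 = {y} \<and> P = P1 \<union> P2"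
    using assms
  proof (induction)
    case (edge x z)
    then show ?case by simp
  next
    case (step y' z P x)
    show ?case
    proof (cases "y = y'")
      case True
      have "\<Union>{{x, y}} \<inter> \<Union>P = {y}"
        using step.hyps upathD(1)[OF step.hyps(1)] True by auto
      then show ?thesis
        using upath.edge[of x y] step True by (metis insert_is_Un)
    next
      case False
      then have "y \<in> \<Union>P"
        using step.prems by auto
      then obtain P1 P2 where 1: "upath y' y P1" "upath y z P2" "\<Union>P1 \<inter> \<Union>P2 = {y}" "P = P1 \<union> P2"
        using step.IH step.prems False by blast
      have "x \<notin> \<Union>P1" "x \<notin> \<Union>P2"
        using step.hyps(2) 1(4) by auto
      moreover have "y' \<in> \<Union>P1"
        using upathD(1)[OF 1(1)] .
      ultimately have "upath x y (insert {x, y'} P1)" "\<Union>(insert {x, y'} P1) \<inter> \<Union>P2 = {y}"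
        using 1 upath.step[OF 1(1)] by auto
      then show ?thesis
        using 1(2,4) by (intro exI[of _ "insert {x, y'} P1"] exI[of _ P2]) simp
    qed
  qed
  then obtain P1 P2 where 1: "upath x y P1" "upath y z P2" "\<Union>P1 \<inter> \<Union>P2 = {y}" "P = P1 \<union> P2"
    by blast
  moreover have "P1 \<inter> P2 = {}"
    using edge_sets_disjoint[OF upathD(7)[OF 1(1)]] 1(3) by simp
  ultimately show ?thesis
    by (rule that)
qed

text \<open>This serves to exclude cycles of length two: two paths of one edge with the same ends
  are equal.\<close>

lemma upath_card_1:
  assumes "upath x y P" "card P = 1"
  shows "P = {{x, y}}"
  using assms
proof cases
  case (step y' Q)
  have "{x, y'} \<notin> Q"
    using step(3) by blast
  then have "card P = card Q + 1"
    using upathD(4)[OF step(2)] step(1) by simp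
  then show ?thesis
    using upathD(4)[OF step(2)] upath_nonempty[OF step(2)] assms(2) by simp
qed simp

section \<open>Cycles as pairs of internally disjoint paths\<close>

definition cycle_split :: "'a \<Rightarrow> 'a \<Rightarrow> 'a set set \<Rightarrow> 'a set set \<Rightarrow> bool" where
  "cycle_split a b P Q \<longleftrightarrow> upath a b P \<and> upath a b Q \<and> \<Union>P \<inter> \<Union>Q = {a, b} \<and> P \<inter> Q = {}"

text \<open>With two named paths, a cycle is at once in the form required by theta curves. The
  condition \<open>P \<inter> Q = {}\<close> in \<open>cycle_split\<close> excludes exactly the
  degenerate case where both paths are the edge from \<open>a\<close> to \<open>b\<close>.\<close>

definition cycle :: "'a set set \<Rightarrow> bool" where
  "cycle C \<longleftrightarrow> (\<exists>a b P Q. cycle_split a b P Q \<and> C = P \<union> Q)"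

lemma cycle_split_sym: "cycle_split a b P Q \<Longrightarrow> cycle_split b a P Q"
  unfolding cycle_split_def by (simp add: upath_sym insert_commute)

lemma cycle_split_commute: "cycle_split a b P Q \<Longrightarrow> cycle_split a b Q P"
  unfolding cycle_split_def by blast

lemma cycle_split_move:
  assumes "cycle_split a b P Q" "y \<in> \<Union>(P \<union> Q)" "y \<noteq> a"
  shows "\<exists>P' Q'. cycle_split a y P' Q' \<and> P' \<union> Q' = P \<union> Q"
proof -
  \<comment> \<open>For \<open>y\<close> inside \<open>P\<close>, cut \<open>P\<close> at
    \<open>y\<close>: the first piece is one side, and \<open>Q\<close> followed by the second piece
    backwards is the other. A vertex of \<open>Q\<close> is treated by exchanging the sides.\<close>
  have *: "\<exists>P' Q'. cycle_split a y P' Q' \<and> P' \<union> Q' = P \<union> Q"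
    if ab: "cycle_split a b P Q" and y: "y \<in> \<Union>P" "y \<noteq> b" for P Q
  proof -
    have PQ: "upath a b P" "upath a b Q" "\<Union>P \<inter> \<Union>Q = {a, b}" "P \<inter> Q = {}"
      using ab by (auto simp: cycle_split_def)
    obtain P1 P2 where 1: "upath a y P1" "upath y b P2" "\<Union>P1 \<inter> \<Union>P2 = {y}" "P = P1 \<union> P2"
      "P1 \<inter> P2 = {}"
      by (rule upath_split[OF PQ(1) y(1) assms(3) y(2)])
    have e: "a \<in> \<Union>P1" "b \<in> \<Union>P2" "y \<in> \<Union>P1" "y \<in> \<Union>P2" "a \<in> \<Union>Q" "b \<in> \<Union>Q"
      using upathD(1,2)[OF 1(1)] upathD(1,2)[OF 1(2)] upathD(1,2)[OF PQ(2)] by simp_all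
    have *: "Z \<inter> Y = {b} \<and> X \<inter> (Z \<union> Y) = {a, y}"
      if "X \<inter> Y = {y}" "(X \<union> Y) \<inter> Z = {a, b}" "a \<in> X" "b \<in> Y" "y \<in> X" for X Y Z :: "'a set"
    proof
      have "a \<notin> Y" "b \<notin> X"
        using that(1,3,4) assms(3) y(2) by (metis IntI singletonD)+
      then show "Z \<inter> Y = {b}" "X \<inter> (Z \<union> Y) = {a, y}"
        using that by (auto simp: set_eq_iff; metis)+
    qed
    have "(\<Union>P1 \<union> \<Union>P2) \<inter> \<Union>Q = {a, b}"
      using PQ(3) 1(4) by simp
    from *[OF 1(3) this e(1-3)] have i: "\<Union>Q \<inter> \<Union>P2 = {b}" "\<Union>P1 \<inter> \<Union>(Q \<union> P2) = {a, y}"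
      by simp_all
    have "upath a y (Q \<union> P2)"
      by (rule upath_trans[OF PQ(2) upath_sym[OF 1(2)] i(1)])
    moreover note i(2)
    moreover have "P1 \<inter> (Q \<union> P2) = {}"
      using 1(4,5) PQ(4) by blast
    ultimately have "cycle_split a y P1 (Q \<union> P2)"
      using 1(1) by (simp add: cycle_split_def)
    then show ?thesis
      using 1(4) by blast
  qed
  show ?thesis
  proof (cases "y = b")
    case True
    then show ?thesis
      using assms by blast
  next
    case False
    show ?thesis
    proof (cases "y \<in> \<Union>P")
      case True
      then show ?thesis
        using *[OF assms(1)] False by simp
    next
      case nP: False
      then show ?thesis
        using *[OF cycle_split_commute[OF assms(1)]] False assms(2) by (simp add: Un_commute)
    qed
  qed
qed

text \<open>Two moves suffice: one end of the given split is moved to \<open>x\<close>, then, after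
  exchanging the ends, the other one to \<open>y\<close>.\<close>

lemma cycle_obtain_split:
  assumes "cycle C" "x \<in> \<Union>C" "y \<in> \<Union>C" "x \<noteq> y"
  obtains P Q where "cycle_split x y P Q" "C = P \<union> Q"
proof -
  obtain a b P Q where 1: "cycle_split a b P Q" "C = P \<union> Q"
    using assms(1) by (auto simp: cycle_def)
  have "\<exists>a P Q. cycle_split a x P Q \<and> C = P \<union> Q"
  proof (cases "x = a")
    case True
    then show ?thesis
      using cycle_split_sym[OF 1(1)] 1(2) by blast
  next
    case False
    then show ?thesis
      using cycle_split_move[OF 1(1)] 1(2) assms(2) by metis
  qed
  then obtain a P Q where 2: "cycle_split a x P Q" "C = P \<union> Q"
    by blast
  then have "\<exists>P Q. cycle_split x y P Q \<and> C = P \<union> Q"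
    using cycle_split_move[OF cycle_split_sym[OF 2(1)]] assms(3,4) by metis
  then show ?thesis
    using that by blast
qed

lemma cycleD:
  assumes "cycle C"
  shows "finite C" "card (\<Union>C) = card C" "card C \<ge> 3" "\<forall>e\<in>C. card e = 2"
proof -
  obtain a b P Q where PQ: "upath a b P" "upath a b Q" "\<Union>P \<inter> \<Union>Q = {a, b}" "P \<inter> Q = {}"
    and C: "C = P \<union> Q"
    using assms by (auto simp: cycle_def cycle_split_def)
  note P = upathD[OF PQ(1)] and Q = upathD[OF PQ(2)]
  show "finite C" "\<forall>e\<in>C. card e = 2"
    using P Q C by auto
  have c: "card C = card P + card Q"
    using C PQ(4) P(4) Q(4) by (simp add: card_Un_disjoint)
  have "card (\<Union>P \<union> \<Union>Q) + card {a, b} = card (\<Union>P) + card (\<Union>Q)"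
    using card_Un_Int[OF P(5) Q(5)] PQ(3) by simp
  then show "card (\<Union>C) = card C"
    using C c P(3,6) Q(6) by (simp add: Union_Un_distrib)
  have "card P \<noteq> 0" "card Q \<noteq> 0"
    using upath_nonempty[OF PQ(1)] upath_nonempty[OF PQ(2)] P(4) Q(4) by auto
  moreover have "\<not> (card P = 1 \<and> card Q = 1)"
    using upath_card_1[OF PQ(1)] upath_card_1[OF PQ(2)] PQ(4) by auto
  ultimately show "card C \<ge> 3"
    using c by linarith
qed

section \<open>Walks, paths and ears\<close>

abbreviation reachable :: "'a set set \<Rightarrow> 'a \<Rightarrow> 'a \<Rightarrow> bool" where
  "reachable D \<equiv> (\<lambda>x y. {x, y} \<in> D)\<^sup>*\<^sup>*"

text \<open>Loops are erased as the walk grows: if the next vertex already lies on the path, the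
  path is cut there instead of being extended.\<close>

lemma reachable_imp_upath:
  assumes "reachable D x y" "\<forall>e\<in>D. card e = 2" "x \<noteq> y"
  shows "\<exists>P\<subseteq>D. upath x y P"
  using assms
proof (induction)
  case base
  then show ?case by simp
next
  case (step y z)
  have yz: "y \<noteq> z"
    using step.hyps(2) step.prems(1) by fastforce
  show ?case
  proof (cases "x = y")
    case True
    then show ?thesis
      using upath.edge[OF yz] step.hyps(2) by blast
  next
    case False
    then obtain P where P: "P \<subseteq> D" "upath x y P"
      using step by blast
    show ?thesis
    proof (cases "z \<in> \<Union>P")
      case True
      then obtain P1 P2 where "upath x z P1" "P = P1 \<union> P2"
        using upath_split[OF P(2) True] yz step.prems(2) by metis
      then show ?thesis
        using P(1) by blast
    next
      case False
      have "upath z x (insert {z, y} P)"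
        using upath.step[OF upath_sym[OF P(2)] False] .
      then show ?thesis
        using upath_sym P(1) step.hyps(2) by (metis insert_commute insert_subset)
    qed
  qed
qed

text \<open>As long as an inner vertex of the path lies in \<open>S\<close>, the piece before it is
  a shorter path with both ends in \<open>S\<close>.\<close>

lemma upath_ear:
  assumes "upath x y P" "x \<in> S" "y \<in> S"
  shows "\<exists>a b Q. upath a b Q \<and> Q \<subseteq> P \<and> \<Union>Q \<inter> S = {a, b}"
  using assms
proof (induction "card P" arbitrary: x y P rule: less_induct)
  case less
  show ?case
  proof (cases "\<Union>P \<inter> S = {x, y}")
    case True
    then show ?thesis
      using less.prems by blast
  next
    case False
    then obtain z where z: "z \<in> \<Union>P" "z \<in> S" "z \<noteq> x" "z \<noteq> y"
      using less.prems upathD(1,2)[OF less.prems(1)] by blast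
    obtain P1 P2 where 1: "upath x z P1" "upath z y P2" "\<Union>P1 \<inter> \<Union>P2 = {z}" "P = P1 \<union> P2" "P1 \<inter> P2 = {}"
      by (rule upath_split[OF less.prems(1) z(1,3,4)])
    then have "card P1 < card P"
      using upath_nonempty[OF 1(2)] upathD(4)[OF less.prems(1)]
      by (intro psubset_card_mono) auto
    then show ?thesis
      using less.hyps[of P1 x z] 1 less.prems z(2) by blast
  qed
qed

subsection \<open>Faces and ears of a plane drawing\<close>

locale drawing =
  fixes V :: "'a set" and E :: "'a set set" and p :: "'a \<Rightarrow> complex"
    and \<gamma> :: "'a set \<Rightarrow> real \<Rightarrow> complex"
  assumes simple: "simple_graph V E" and drawn: "plane_drawing V E p \<gamma>"
begin

lemma finite_V: "finite V" and edge_subset: "e \<in> E \<Longrightarrow> e \<subseteq> V" and card_edge: "e \<in> E \<Longrightarrow> card e = 2"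
  using simple by (auto simp: simple_graph_def)

lemma finite_E: "finite E"
  by (rule finite_subset[of _ "Pow V"]) (use edge_subset finite_V in auto)

lemma Union_subset_V: "P \<subseteq> E \<Longrightarrow> \<Union>P \<subseteq> V"
  using edge_subset by blast

lemma inj_p: "inj_on p V"
  using drawn by (simp add: plane_drawing_def)

lemma edge_arc: "e \<in> E \<Longrightarrow> arc (\<gamma> e)"
  and edge_ends: "e \<in> E \<Longrightarrow> {pathstart (\<gamma> e), pathfinish (\<gamma> e)} = p ` e"
  and edge_Int_V: "e \<in> E \<Longrightarrow> path_image (\<gamma> e) \<inter> p ` V = p ` e"
  and edge_Int_edge: "e \<in> E \<Longrightarrow> f \<in> E \<Longrightarrow> e \<noteq> f \<Longrightarrow>
    path_image (\<gamma> e) \<inter> path_image (\<gamma> f) = p ` (e \<inter> f)"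
  using drawn by (auto simp: plane_drawing_def)

definition img :: "'a set set \<Rightarrow> complex set" where
  "img P = (\<Union>e\<in>P. path_image (\<gamma> e))"

lemma img_Un: "img (P \<union> Q) = img P \<union> img Q"
  by (simp add: img_def)

lemma img_mono: "P \<subseteq> Q \<Longrightarrow> img P \<subseteq> img Q"
  by (auto simp: img_def)

lemma vertex_in_img:
  assumes "P \<subseteq> E" "v \<in> V"
  shows "p v \<in> img P \<longleftrightarrow> v \<in> \<Union>P"
proof
  assume "p v \<in> img P"
  then obtain e where e: "e \<in> P" "p v \<in> path_image (\<gamma> e)"
    by (auto simp: img_def)
  then have "p v \<in> p ` e"
    using edge_Int_V[of e] assms by blast
  then show "v \<in> \<Union>P"
    using inj_onD[OF inj_p] assms edge_subset[of e] e(1) by blast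
next
  assume "v \<in> \<Union>P"
  then obtain e where "e \<in> P" "v \<in> e"
    by blast
  then show "p v \<in> img P"
    using edge_Int_V[of e] assms(1) by (auto simp: img_def)
qed

text \<open>The bridge from incidence to topology: distinct edges meet only in common ends, so
  edge-disjoint subgraphs meet only in the points of common vertices. All intersection conditions on
  arcs are obtained from it.\<close>

lemma img_Int:
  assumes "P \<subseteq> E" "Q \<subseteq> E" "P \<inter> Q = {}"
  shows "img P \<inter> img Q = p ` (\<Union>P \<inter> \<Union>Q)"
proof
  show "img P \<inter> img Q \<subseteq> p ` (\<Union>P \<inter> \<Union>Q)"
  proof
    fix z assume "z \<in> img P \<inter> img Q"
    then obtain e f where ef: "e \<in> P" "f \<in> Q" "z \<in> path_image (\<gamma> e)" "z \<in> path_image (\<gamma> f)"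
      by (auto simp: img_def)
    then have "e \<noteq> f" "e \<in> E" "f \<in> E"
      using assms by auto
    then have "z \<in> p ` (e \<inter> f)"
      using edge_Int_edge ef by blast
    then show "z \<in> p ` (\<Union>P \<inter> \<Union>Q)"
      using ef by blast
  qed
  show "p ` (\<Union>P \<inter> \<Union>Q) \<subseteq> img P \<inter> img Q"
    using vertex_in_img[OF assms(1)] vertex_in_img[OF assms(2)] Union_subset_V[OF assms(1)] by blast
qed

lemma img_edge:
  assumes "{x, y} \<in> E"
  shows "arc_between (p x) (p y) (path_image (\<gamma> {x, y}))"
proof -
  have "arc_between (pathstart (\<gamma> {x, y})) (pathfinish (\<gamma> {x, y})) (path_image (\<gamma> {x, y}))"
    using edge_arc[OF assms] by (auto simp: arc_between_def)
  moreover have "{pathstart (\<gamma> {x, y}), pathfinish (\<gamma> {x, y})} = {p x, p y}"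
    using edge_ends[OF assms] by simp
  ultimately show ?thesis
    by (auto simp: doubleton_eq_iff intro: arc_between_sym)
qed

lemma img_upath:
  assumes "upath x y P" "P \<subseteq> E"
  shows "arc_between (p x) (p y) (img P)"
  using assms
proof induction
  case (edge x y)
  then show ?case
    using img_edge by (simp add: img_def)
next
  case (step y z P x)
  have "y \<in> \<Union>P"
    using upathD(1)[OF step.hyps(1)] .
  then have "\<Union>{{x, y}} \<inter> \<Union>P = {y}"
    using step.hyps(2) by auto
  moreover have "{x, y} \<notin> P"
    using step.hyps(2) by blast
  ultimately have "img {{x, y}} \<inter> img P = {p y}"
    using img_Int[of "{{x, y}}" P] step.prems by simp
  moreover have "arc_between (p x) (p y) (img {{x, y}})" "arc_between (p y) (p z) (img P)"
    using img_edge[of x y] step by (simp_all add: img_def)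
  ultimately have "arc_between (p x) (p z) (img {{x, y}} \<union> img P)"
    by (intro arc_between_join)
  then show ?case
    by (simp add: img_def)
qed

lemma cycle_split_arcs:
  assumes "cycle_split x y P Q" "P \<subseteq> E" "Q \<subseteq> E"
  shows "arc_between (p x) (p y) (img P)" "arc_between (p x) (p y) (img Q)"
    "img P \<inter> img Q = {p x, p y}"
proof -
  show "arc_between (p x) (p y) (img P)" "arc_between (p x) (p y) (img Q)"
    using img_upath assms by (auto simp: cycle_split_def)
  show "img P \<inter> img Q = {p x, p y}"
    using img_Int[of P Q] assms by (simp add: cycle_split_def)
qed

lemma cycle_curve:
  assumes "cycle C" "C \<subseteq> E"
  shows "closed_curve (img C)"
proof -
  obtain a b P Q where "cycle_split a b P Q" "C = P \<union> Q"
    using assms(1) by (auto simp: cycle_def)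
  then show ?thesis
    using closed_curve_Un[OF cycle_split_arcs] assms(2) by (simp add: img_Un)
qed

section \<open>Faces and the addition of an ear\<close>

text \<open>\<open>F\<close> collects the boundary cycles of the bounded faces of \<open>H\<close>, and \<open>D\<close> is the boundary of the
  unbounded one.\<close>

definition faces :: "'a set set \<Rightarrow> 'a set set set \<Rightarrow> 'a set set \<Rightarrow> bool" where
  "faces H F D \<longleftrightarrow> H \<subseteq> E \<and> finite F \<and> (\<forall>C\<in>F. cycle C \<and> C \<subseteq> H) \<and> cycle D \<and> D \<subseteq> H \<and>
     disjoint_family_on (\<lambda>C. inside (img C)) F \<and> (\<forall>C\<in>F. inside (img C) \<subseteq> inside (img D)) \<and>
     - img H = outside (img D) \<union> (\<Union>C\<in>F. inside (img C)) \<and>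
     card F + card (\<Union>H) = card H + 1 \<and> (\<Sum>C\<in>F. card C) + card D = 2 * card H"

lemma facesD:
  assumes "faces H F D"
  shows "H \<subseteq> E" "finite F" "C \<in> F \<Longrightarrow> cycle C" "C \<in> F \<Longrightarrow> C \<subseteq> H" "cycle D" "D \<subseteq> H"
    "disjoint_family_on (\<lambda>C. inside (img C)) F" "C \<in> F \<Longrightarrow> inside (img C) \<subseteq> inside (img D)"
    "- img H = outside (img D) \<union> (\<Union>C\<in>F. inside (img C))"
    "card F + card (\<Union>H) = card H + 1" "(\<Sum>C\<in>F. card C) + card D = 2 * card H" "finite H"
    "finite (\<Union>H)"
proof -
  show "H \<subseteq> E" "finite F" "C \<in> F \<Longrightarrow> cycle C" "C \<in> F \<Longrightarrow> C \<subseteq> H" "cycle D" "D \<subseteq> H"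
    "disjoint_family_on (\<lambda>C. inside (img C)) F" "C \<in> F \<Longrightarrow> inside (img C) \<subseteq> inside (img D)"
    "- img H = outside (img D) \<union> (\<Union>C\<in>F. inside (img C))"
    "card F + card (\<Union>H) = card H + 1" "(\<Sum>C\<in>F. card C) + card D = 2 * card H"
    using assms by (simp_all add: faces_def)
  show "finite H"
    by (rule finite_subset[OF \<open>H \<subseteq> E\<close> finite_E])
  show "finite (\<Union>H)"
    by (rule finite_subset[OF Union_subset_V[OF \<open>H \<subseteq> E\<close>] finite_V])
qed

text \<open>The base case: the cycle bounds both the bounded and the unbounded face, so each edge is
  counted twice.\<close>

lemma faces_cycle:
  assumes "cycle C" "C \<subseteq> E"
  shows "faces C {C} C"
  using assms cycleD[OF assms(1)] by (simp add: faces_def disjoint_family_on_def Un_commute)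

text \<open>The condition \<open>P \<inter> H = {}\<close> prevents an edge of \<open>H\<close> from
  being an ear of \<open>H\<close> itself; chords remain allowed.\<close>

definition ear :: "'a set set \<Rightarrow> 'a \<Rightarrow> 'a \<Rightarrow> 'a set set \<Rightarrow> bool" where
  "ear H x y P \<longleftrightarrow> upath x y P \<and> P \<subseteq> E \<and> P \<inter> H = {} \<and> \<Union>P \<inter> \<Union>H = {x, y}"

text \<open>The ends of the ear are limits of its open arc, so they lie in \<open>R\<close> or on
  its boundary curve. They also lie on \<open>img H\<close>, which avoids \<open>R\<close>, and
  hence on the curve of \<open>C\<close>.\<close>

lemma ear_endpoints:
  assumes H: "H \<subseteq> E" and ear: "ear H x y P" and C: "cycle C" "C \<subseteq> H"
    and R: "R \<in> {inside (img C), outside (img C)}" "R \<inter> img H = {}" "img P - {p x, p y} \<subseteq> R"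
  shows "x \<in> \<Union>C" "y \<in> \<Union>C"
proof -
  have P: "upath x y P" "P \<subseteq> E" "P \<inter> H = {}" "\<Union>P \<inter> \<Union>H = {x, y}"
    using ear by (auto simp: ear_def)
  have cl: "closed (img C)"
    using closed_curveD(1)[OF cycle_curve[OF C(1) subset_trans[OF C(2) H]]] .
  have "closure R \<subseteq> img C \<union> R"
    using R(1) closure_inside_subset[OF cl] closure_outside_subset[OF cl] by auto
  moreover have "closure (img P - {p x, p y}) = img P"
    by (rule arc_betweenD(8)[OF img_upath[OF P(1,2)]])
  ultimately have "img P \<subseteq> img C \<union> R"
    using closure_mono[OF R(3)] by simp
  moreover have "img P \<inter> img H = {p x, p y}"
    using img_Int[OF P(2) H P(3)] P(4) by simp
  ultimately have "p x \<in> img C" "p y \<in> img C"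
    using R(2) by (metis Int_iff UnE empty_iff insertCI subsetD)+
  moreover have "{x, y} \<subseteq> \<Union>H"
    using P(4) by auto
  then have "{x, y} \<subseteq> V"
    using Union_subset_V[OF H] by blast
  ultimately show "x \<in> \<Union>C" "y \<in> \<Union>C"
    using vertex_in_img[of C] C(2) H by auto
qed

text \<open>An ear of k edges brings k - 1 new vertices, since its two ends are old. So m - n grows
  by one, which matches one additional face.\<close>

lemma ear_count:
  assumes "faces H F D" "ear H x y P"
  shows "card (H \<union> P) = card H + card P" "card (\<Union>(H \<union> P)) + 1 = card (\<Union>H) + card P"
proof -
  have P: "upath x y P" "P \<inter> H = {}" "\<Union>P \<inter> \<Union>H = {x, y}"
    using assms(2) by (auto simp: ear_def)
  show "card (H \<union> P) = card H + card P"
    using P(2) facesD(12)[OF assms(1)] upathD(4)[OF P(1)] by (simp add: card_Un_disjoint Int_commute)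
  have "card (\<Union>H \<union> \<Union>P) + card {x, y} = card (\<Union>H) + card (\<Union>P)"
    using card_Un_Int[OF facesD(13)[OF assms(1)] upathD(5)[OF P(1)]] P(3) by (simp add: Int_commute)
  then show "card (\<Union>(H \<union> P)) + 1 = card (\<Union>H) + card P"
    using upathD(3,6)[OF P(1)] by (simp add: Union_Un_distrib)
qed

lemma ear_split:
  assumes "H \<subseteq> E" "ear H x y P" "cycle_split x y Q R" "Q \<subseteq> H"
  shows "cycle_split x y Q P" "cycle (Q \<union> P)" "img Q \<inter> img P = {p x, p y}"
    "card (Q \<union> P) = card Q + card P"
proof -
  have P: "upath x y P" "P \<subseteq> E" "P \<inter> H = {}" "\<Union>P \<inter> \<Union>H = {x, y}"
    using assms(2) by (auto simp: ear_def)
  have Q: "upath x y Q"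
    using assms(3) by (simp add: cycle_split_def)
  have xy: "{x, y} \<subseteq> \<Union>Q"
    using upathD(1,2)[OF Q] by simp
  have "\<Union>Q \<subseteq> \<Union>H"
    using assms(4) by (rule Union_mono)
  then have "\<Union>Q \<inter> \<Union>P \<subseteq> {x, y}"
    using P(4) by blast
  moreover have "{x, y} \<subseteq> \<Union>P"
    using upathD(1,2)[OF P(1)] by simp
  ultimately have "\<Union>Q \<inter> \<Union>P = {x, y}"
    using xy by (intro subset_antisym Int_greatest)
  moreover have QP: "Q \<inter> P = {}"
    using assms(4) P(3) by blast
  ultimately show *: "cycle_split x y Q P"
    using P(1) Q by (simp add: cycle_split_def)
  then show "cycle (Q \<union> P)"
    unfolding cycle_def by blast
  show "img Q \<inter> img P = {p x, p y}"
    by (rule cycle_split_arcs(3)[OF * subset_trans[OF assms(4,1)] P(2)])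
  show "card (Q \<union> P) = card Q + card P"
    using QP upathD(4)[OF P(1)] upathD(4)[OF Q] by (simp add: card_Un_disjoint)
qed

text \<open>The ear is a chord of the face bounded by \<open>C\<close>. It divides \<open>C\<close>
  into \<open>Q\<close> and \<open>R\<close>, and the face is replaced by those of
  \<open>Q \<union> P\<close> and \<open>R \<union> P\<close>; the outer boundary stays.\<close>

lemma faces_ear_inside:
  assumes F: "faces H F D" and ear: "ear H x y P" and C: "C \<in> F"
    and PC: "img P - {p x, p y} \<subseteq> inside (img C)"
  shows "\<exists>F'. faces (H \<union> P) F' D"
proof -
  note FD = facesD[OF F]
  let ?I = "\<lambda>C. inside (img C)"
  have P: "upath x y P" "P \<subseteq> E" "P \<inter> H = {}" "\<Union>P \<inter> \<Union>H = {x, y}"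
    using ear by (auto simp: ear_def)
  have PH: "img P \<inter> img H = {p x, p y}"
    using img_Int[OF P(2) FD(1) P(3)] P(4) by simp
  have IH: "?I B \<inter> img H = {}" if "B \<in> F" for B
    using FD(9) that by blast
  have "x \<in> \<Union>C" "y \<in> \<Union>C"
    using ear_endpoints[OF FD(1) ear FD(3)[OF C] FD(4)[OF C], of "?I C"] IH[OF C] PC by auto
  then obtain Q R where QR: "cycle_split x y Q R" "C = Q \<union> R"
    using cycle_obtain_split[OF FD(3)[OF C]] upathD(3)[OF P(1)] by metis
  have sub: "Q \<subseteq> H" "R \<subseteq> H"
    using FD(4)[OF C] QR(2) by auto
  note sQ = ear_split[OF FD(1) ear QR(1) sub(1)]
  note sR = ear_split[OF FD(1) ear cycle_split_commute[OF QR(1)] sub(2)]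
  note aQR = cycle_split_arcs[OF QR(1) subset_trans[OF sub(1) FD(1)] subset_trans[OF sub(2) FD(1)]]
  have aP: "arc_between (p x) (p y) (img P)"
    by (rule img_upath[OF P(1,2)])
  have iC: "img C = img Q \<union> img R"
    by (simp add: QR(2) img_Un)
  have "img P \<inter> inside (img Q \<union> img R) \<noteq> {}"
    using PC arc_betweenD(6)[OF aP] unfolding iC by blast
  note th = theta_split[OF aQR(1,2) aP aQR(3) sQ(3) sR(3) this]
  have I12: "?I (Q \<union> P) \<inter> ?I (R \<union> P) = {}"
    "?I (Q \<union> P) \<union> ?I (R \<union> P) \<union> (img P - {p x, p y}) = ?I C"
    using th by (simp_all add: img_Un iC)
  have IP: "B \<inter> img P = {}" if "B \<inter> ?I C = {}" "B \<inter> img H = {}" for B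
    using that PC PH by blast
  have I_sub: "?I (Q \<union> P) \<subseteq> ?I C" "?I (R \<union> P) \<subseteq> ?I C"
    using I12(2) by auto
  have disjC: "?I B \<inter> ?I C = {}" if "B \<in> F - {C}" for B
    using FD(7) that C by (auto simp: disjoint_family_on_def)
  let ?F = "insert (Q \<union> P) (insert (R \<union> P) (F - {C}))"
  have P0: "P \<noteq> {}"
    by (rule upath_nonempty[OF P(1)])
  \<comment> \<open>The new cycles use edges of \<open>P\<close>, none of which is in
    \<open>H\<close>. That they are new and distinct is what makes the number of faces grow by
    exactly one.\<close>
  have nF: "Q \<union> P \<notin> F" "R \<union> P \<notin> F"
    using FD(4) P(3) P0 by blast+
  have "Q \<noteq> {}" "Q \<inter> R = {}" "Q \<inter> P = {}"
    using QR(1) sQ(1) upath_nonempty by (auto simp: cycle_split_def)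
  then have ne: "Q \<union> P \<noteq> R \<union> P"
    by blast
  have dis: "disjoint_family_on ?I ?F"
  proof -
    have 1: "disjoint_family_on ?I (F - {C})"
      using FD(7) by (rule disjoint_family_on_mono[rotated]) auto
    have 2: "?I (Q \<union> P) \<inter> ?I B = {}" "?I (R \<union> P) \<inter> ?I B = {}" if "B \<in> F - {C}" for B
      using disjC[OF that] I_sub by blast+
    then have "?I (Q \<union> P) \<inter> (\<Union>B\<in>F - {C}. ?I B) = {}" "?I (R \<union> P) \<inter> (\<Union>B\<in>F - {C}. ?I B) = {}"
      by blast+
    then show ?thesis
      using nF ne 1 I12(1) by (simp add: disjoint_family_on_insert Int_Un_distrib)
  qed
  \<comment> \<open>Removing the ear affects only the inside of \<open>C\<close>, which falls into
    the two new insides; all other regions are disjoint from the ear.\<close>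
  have compl: "- img (H \<union> P) = outside (img D) \<union> (\<Union>C\<in>?F. ?I C)"
  proof -
    have "outside (img D) \<inter> ?I C = {}"
      using FD(8)[OF C] inside_Int_outside[of "img D"] by blast
    moreover have "outside (img D) \<inter> img H = {}"
      using FD(9) by blast
    ultimately have o: "outside (img D) - img P = outside (img D)"
      using IP by blast
    have "?I B - img P = ?I B" if "B \<in> F - {C}" for B
      using IP[of "?I B"] disjC[OF that] IH that by blast
    then have u: "(\<Union>B\<in>F - {C}. ?I B) - img P = (\<Union>B\<in>F - {C}. ?I B)"
      by blast
    have "?I (Q \<union> P) \<inter> img P = {}" "?I (R \<union> P) \<inter> img P = {}"
      by (simp_all only: img_Un inside_Un_disjoint)
    then have c: "?I C - img P = ?I (Q \<union> P) \<union> ?I (R \<union> P)"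
      unfolding I12(2)[symmetric] by blast
    have "- img (H \<union> P) = - img H - img P"
      by (auto simp: img_Un)
    also have "\<dots> = (outside (img D) \<union> (?I C \<union> (\<Union>B\<in>F - {C}. ?I B))) - img P"
      using FD(9) C by blast
    also have "\<dots> = outside (img D) \<union> (?I C - img P) \<union> (\<Union>B\<in>F - {C}. ?I B)"
      using o u by (simp add: Un_Diff Un_assoc)
    also have "\<dots> = outside (img D) \<union> (\<Union>C\<in>?F. ?I C)"
      unfolding c by auto
    finally show ?thesis .
  qed
  have cF: "card F = card (F - {C}) + 1" "(\<Sum>C\<in>F. card C) = card C + (\<Sum>C\<in>F - {C}. card C)"
    using card.remove[OF FD(2) C] sum.remove[OF FD(2) C, of card] by linarith+
  have *: "card (insert A (insert B G)) = card G + 2"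
    "(\<Sum>C\<in>insert A (insert B G). card C) = card A + card B + (\<Sum>C\<in>G. card C)"
    if "finite G" "A \<notin> G" "B \<notin> G" "A \<noteq> B" for A B and G :: "'a set set set"
    using that by simp_all
  have cF': "card ?F = card (F - {C}) + 2"
    "(\<Sum>C\<in>?F. card C) = card (Q \<union> P) + card (R \<union> P) + (\<Sum>C\<in>F - {C}. card C)"
    using nF ne FD(2) by (intro *; blast)+
  have cC: "card C = card Q + card R"
    using QR(2) \<open>Q \<inter> R = {}\<close> cycleD(1)[OF FD(3)[OF C]] by (simp add: card_Un_disjoint)
  have "card ?F + card (\<Union>(H \<union> P)) = card (H \<union> P) + 1"
    using cF cF' FD(10) ear_count[OF F ear] by linarith
  moreover have "(\<Sum>C\<in>?F. card C) + card D = 2 * card (H \<union> P)"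
    using cF cF' FD(11) ear_count[OF F ear] cC sQ(4) sR(4) by linarith
  moreover have "\<forall>B\<in>?F. cycle B \<and> B \<subseteq> H \<union> P"
    using FD(3,4) sQ(2) sR(2) sub by auto
  moreover have "\<forall>B\<in>?F. ?I B \<subseteq> ?I D"
    using FD(8) C I_sub by auto
  ultimately have "faces (H \<union> P) ?F D"
    unfolding faces_def using FD(1,2,5,6) P(2) dis compl by auto
  then show ?thesis
    by blast
qed

text \<open>The ear encloses a new bounded face together with one side \<open>Q\<close> of the outer
  cycle. The other side \<open>R\<close> and the ear form the new outer boundary, while all old
  faces stay.\<close>

lemma faces_ear_outside:
  assumes F: "faces H F D" and ear: "ear H x y P"
    and PD: "img P - {p x, p y} \<subseteq> outside (img D)"
  shows "\<exists>F' D'. faces (H \<union> P) F' D'"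
proof -
  note FD = facesD[OF F]
  let ?I = "\<lambda>C. inside (img C)"
  have P: "upath x y P" "P \<subseteq> E" "P \<inter> H = {}" "\<Union>P \<inter> \<Union>H = {x, y}"
    using ear by (auto simp: ear_def)
  have PH: "img P \<inter> img H = {p x, p y}"
    using img_Int[OF P(2) FD(1) P(3)] P(4) by simp
  have IH: "?I B \<inter> img H = {}" if "B \<in> F" for B
    using FD(9) that by blast
  have OH: "outside (img D) \<inter> img H = {}"
    using FD(9) by blast
  have "x \<in> \<Union>D" "y \<in> \<Union>D"
    using ear_endpoints[OF FD(1) ear FD(5) FD(6), of "outside (img D)"] OH PD by auto
  then obtain Q0 R0 where QR0: "cycle_split x y Q0 R0" "D = Q0 \<union> R0"
    using cycle_obtain_split[OF FD(5)] upathD(3)[OF P(1)] by metis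
  have aP: "arc_between (p x) (p y) (img P)"
    by (rule img_upath[OF P(1,2)])
  \<comment> \<open>The ear runs outside \<open>D\<close>, so it is not the middle arc of the theta
    curve. Hence one of the two sides of \<open>D\<close> is, and it is named
    \<open>Q\<close>.\<close>
  have "\<exists>Q R. cycle_split x y Q R \<and> D = Q \<union> R \<and> img Q \<inter> inside (img R \<union> img P) \<noteq> {}"
  proof -
    have sub: "Q0 \<subseteq> H" "R0 \<subseteq> H"
      using FD(6) QR0(2) by auto
    note sQ = ear_split[OF FD(1) ear QR0(1) sub(1)]
    note sR = ear_split[OF FD(1) ear cycle_split_commute[OF QR0(1)] sub(2)]
    note aQR = cycle_split_arcs[OF QR0(1) subset_trans[OF sub(1) FD(1)] subset_trans[OF sub(2) FD(1)]]
    have iD: "img D = img Q0 \<union> img R0"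
      by (simp add: QR0(2) img_Un)
    have "{p x, p y} \<subseteq> img D"
      using arc_betweenD(1,2)[OF aQR(1)] by (simp add: iD)
    then have "img P \<inter> inside (img D) = {}"
      using PD inside_Int_outside[of "img D"] inside_no_overlap[of "img D"] by blast
    then show ?thesis
      using theta_middle[OF aQR(1,2) aP aQR(3) sQ(3) sR(3)] QR0 cycle_split_commute[OF QR0(1)]
      unfolding iD by (metis Un_commute)
  qed
  then obtain Q R where QR: "cycle_split x y Q R" "D = Q \<union> R"
    and mid: "img Q \<inter> inside (img R \<union> img P) \<noteq> {}"
    by blast
  have sub: "Q \<subseteq> H" "R \<subseteq> H"
    using FD(6) QR(2) by auto
  note sQ = ear_split[OF FD(1) ear QR(1) sub(1)]
  note sR = ear_split[OF FD(1) ear cycle_split_commute[OF QR(1)] sub(2)]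
  note aQR = cycle_split_arcs[OF QR(1) subset_trans[OF sub(1) FD(1)] subset_trans[OF sub(2) FD(1)]]
  have iD: "img D = img Q \<union> img R"
    by (simp add: QR(2) img_Un)
  \<comment> \<open>Here the chord is \<open>Q\<close>: it divides the inside of
    \<open>R \<union> P\<close> into the old inside of \<open>D\<close> and the new face.\<close>
  note th = theta_split[OF aQR(2) aP aQR(1) sR(3) trans[OF Int_commute aQR(3)]
    trans[OF Int_commute sQ(3)] mid]
  have I12: "?I D \<inter> ?I (Q \<union> P) = {}"
    "?I D \<union> ?I (Q \<union> P) \<union> (img Q - {p x, p y}) = ?I (R \<union> P)"
    using th by (simp_all add: img_Un iD Un_commute)
  let ?F = "insert (Q \<union> P) F"
  have P0: "P \<noteq> {}"
    by (rule upath_nonempty[OF P(1)])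
  have nF: "Q \<union> P \<notin> F"
    using FD(4) P(3) P0 by blast
  have dis: "disjoint_family_on ?I ?F"
  proof -
    have "?I (Q \<union> P) \<inter> ?I B = {}" if "B \<in> F" for B
      using FD(8)[OF that] I12(1) by blast
    then have "?I (Q \<union> P) \<inter> (\<Union>B\<in>F. ?I B) = {}"
      by blast
    then show ?thesis
      using nF FD(7) by (simp add: disjoint_family_on_insert)
  qed
  have compl: "- img (H \<union> P) = outside (img (R \<union> P)) \<union> (\<Union>C\<in>?F. ?I C)"
  proof -
    have "?I B \<inter> img P = {}" if "B \<in> F" for B
    proof -
      have "?I B \<inter> outside (img D) = {}"
        using FD(8)[OF that] inside_Int_outside[of "img D"] by blast
      then show ?thesis
        using PD PH IH[OF that] by blast
    qed
    then have u: "(\<Union>B\<in>F. ?I B) - img P = (\<Union>B\<in>F. ?I B)"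
      by blast
    have "outside (img D) - img P = - ((img Q \<union> img R) \<union> ?I D) - img P"
      by (simp add: iD outside_inside)
    also have "\<dots> = outside (img (R \<union> P)) \<union> ?I (Q \<union> P)"
    proof -
      have "{p x, p y} \<subseteq> img R"
        using arc_betweenD(1,2)[OF aQR(2)] by simp
      moreover have "?I (Q \<union> P) \<inter> img Q = {}" "?I (Q \<union> P) \<inter> img P = {}"
        "?I (R \<union> P) \<inter> img R = {}"
        by (simp_all only: img_Un inside_Un_disjoint)
      moreover have "outside (img (R \<union> P)) = - (img R \<union> img P \<union> ?I (R \<union> P))"
        by (simp add: outside_inside img_Un)
      ultimately show ?thesis
        using I12 by blast
    qed
    finally have c: "outside (img D) - img P = outside (img (R \<union> P)) \<union> ?I (Q \<union> P)" .
    have "- img (H \<union> P) = - img H - img P"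
      by (auto simp: img_Un)
    also have "\<dots> = (outside (img D) - img P) \<union> (\<Union>B\<in>F. ?I B)"
      unfolding FD(9) Un_Diff u ..
    also have "\<dots> = outside (img (R \<union> P)) \<union> (\<Union>C\<in>?F. ?I C)"
      unfolding c by auto
    finally show ?thesis .
  qed
  have cF: "card ?F = card F + 1" "(\<Sum>C\<in>?F. card C) = card (Q \<union> P) + (\<Sum>C\<in>F. card C)"
    using nF FD(2) by simp_all
  have "Q \<inter> R = {}"
    using QR(1) by (simp add: cycle_split_def)
  then have cD: "card D = card Q + card R"
    using QR(2) cycleD(1)[OF FD(5)] by (simp add: card_Un_disjoint)
  have "card ?F + card (\<Union>(H \<union> P)) = card (H \<union> P) + 1"
    using cF FD(10) ear_count[OF F ear] by linarith
  moreover have "(\<Sum>C\<in>?F. card C) + card (R \<union> P) = 2 * card (H \<union> P)"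
    using cF FD(11) ear_count[OF F ear] cD sQ(4) sR(4) by linarith
  moreover have "\<forall>B\<in>?F. cycle B \<and> B \<subseteq> H \<union> P"
    using FD(3,4) sQ(2) sub by auto
  moreover have "\<forall>B\<in>?F. ?I B \<subseteq> ?I (R \<union> P)"
    using FD(8) I12(2) by blast
  ultimately have "faces (H \<union> P) ?F (R \<union> P)"
    unfolding faces_def using FD(1,2) P(2) sub dis compl sR(2) by auto
  then show ?thesis
    by blast
qed

text \<open>The open ear is connected and avoids \<open>img H\<close>, so it lies in a single
  face.\<close>

lemma faces_ear:
  assumes F: "faces H F D" and ear: "ear H x y P"
  shows "\<exists>F' D'. faces (H \<union> P) F' D'"
proof -
  note FD = facesD[OF F]
  have P: "upath x y P" "P \<subseteq> E" "P \<inter> H = {}" "\<Union>P \<inter> \<Union>H = {x, y}"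
    using ear by (auto simp: ear_def)
  have PH: "img P \<inter> img H = {p x, p y}"
    using img_Int[OF P(2) FD(1) P(3)] P(4) by simp
  have aP: "arc_between (p x) (p y) (img P)"
    by (rule img_upath[OF P(1,2)])
  obtain z where z: "z \<in> img P - {p x, p y}"
    using arc_betweenD(6)[OF aP] by blast
  have c: "connected (img P - {p x, p y})"
    by (rule arc_betweenD(7)[OF aP])
  have dis: "(img P - {p x, p y}) \<inter> img C = {}" if "C \<subseteq> H" for C
    using PH img_mono[OF that] by blast
  have "z \<in> - img H"
    using z PH by blast
  then consider "z \<in> outside (img D)" | C where "C \<in> F" "z \<in> inside (img C)"
    using FD(9) by blast
  then show ?thesis
  proof cases
    case 1
    then have "img P - {p x, p y} \<subseteq> outside (img D)"
      using connected_subset_outside[OF c dis[OF FD(6)]] z by blast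
    then show ?thesis
      by (rule faces_ear_outside[OF F ear])
  next
    case 2
    then have "img P - {p x, p y} \<subseteq> inside (img C)"
      using connected_subset_inside[OF c dis[OF FD(4)[OF 2(1)]]] z by blast
    then show ?thesis
      using faces_ear_inside[OF F ear 2(1)] by blast
  qed
qed

end

subsection \<open>Edge bounds for planar graphs\<close>

definition pairs :: "'a set \<Rightarrow> 'a set set" where
  "pairs T = {e. e \<subseteq> T \<and> card e = 2}"

definition triangles :: "'a set set \<Rightarrow> 'a set set" where
  "triangles E = {T. card T = 3 \<and> pairs T \<subseteq> E}"

lemma card_pairs: "finite T \<Longrightarrow> card (pairs T) = card T choose 2"
  unfolding pairs_def by (rule n_subsets)

lemma card_pairs_3:
  assumes "card T = 3"
  shows "card (pairs T) = 3"
proof -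
  have "finite T"
    using assms by (intro card_ge_0_finite) simp
  then show ?thesis
    using card_pairs[of T] assms by (simp add: choose_two)
qed

lemma Union_pairs:
  assumes "card T = 3"
  shows "\<Union>(pairs T) = T"
proof -
  obtain a b c where "T = {a, b, c}" "a \<noteq> b" "a \<noteq> c" "b \<noteq> c"
    using assms by (auto simp: card_3_iff)
  then have "{a, b} \<in> pairs T" "{a, c} \<in> pairs T"
    by (auto simp: pairs_def)
  then have "T \<subseteq> \<Union>(pairs T)"
    using \<open>T = {a, b, c}\<close> by blast
  then show ?thesis
    by (auto simp: pairs_def)
qed

lemma triangles_subset: "triangles E \<subseteq> Pow (\<Union>E)"
  using Union_pairs by (fastforce simp: triangles_def)

lemma simple_graphD:
  assumes "simple_graph V E"
  shows "finite V" "V \<noteq> {}" "finite E" "\<Union>E \<subseteq> V" "finite (triangles E)" "E \<subseteq> pairs V"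
proof -
  show V: "finite V" "V \<noteq> {}" and E: "\<Union>E \<subseteq> V" and "E \<subseteq> pairs V"
    using assms by (auto simp: simple_graph_def pairs_def)
  show "finite E"
    by (rule finite_UnionD[OF finite_subset[OF E V(1)]])
  show "finite (triangles E)"
    by (rule finite_subset[OF subset_trans[OF triangles_subset Pow_mono[OF E]]]) (simp add: V)
qed

text \<open>Three edges on three vertices are all the pairs. This identifies face boundaries of
  length three, which are edge sets, with triangles, which are vertex sets.\<close>

lemma cycle_3:
  assumes "cycle C" "card C = 3"
  shows "card (\<Union>C) = 3" "C = pairs (\<Union>C)"
proof -
  show c: "card (\<Union>C) = 3"
    using cycleD(2)[OF assms(1)] assms(2) by simp
  have "finite (\<Union>C)"
    using c by (intro card_ge_0_finite) simp
  then have "finite (pairs (\<Union>C))"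
    by (simp add: pairs_def)
  moreover have "C \<subseteq> pairs (\<Union>C)"
    using cycleD(4)[OF assms(1)] by (auto simp: pairs_def)
  ultimately show "C = pairs (\<Union>C)"
    using card_pairs_3[OF c] assms(2) by (intro card_subset_eq) simp_all
qed

section \<open>The edge bounds and their behaviour under gluing\<close>

definition edge_bounds :: "'a set \<Rightarrow> 'a set set \<Rightarrow> bool" where
  "edge_bounds V E \<longleftrightarrow> 2 * card E + 4 \<le> 4 * card V + card (triangles E) \<and>
     (card V \<ge> 3 \<longrightarrow> card E + 6 \<le> 3 * card V)"

text \<open>One vertex and a single edge violate m + 6 \<le> 3n. These weaker forms hold for them
  too, with equality, by m \<le> n(n - 1)/2.\<close>

lemma edge_bounds_small:
  assumes "simple_graph V E" "edge_bounds V E"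
  shows "card E + 3 \<le> 3 * card V" "card V \<ge> 2 \<Longrightarrow> card E + 5 \<le> 3 * card V"
proof -
  note S = simple_graphD[OF assms(1)]
  have "finite (pairs V)"
    using S(1) by (simp add: pairs_def)
  then have c: "card E \<le> card V choose 2"
    using card_mono[OF _ S(6)] card_pairs[OF S(1)] by simp
  have "card V > 0"
    using S(1,2) by (simp add: card_gt_0_iff)
  then consider "card V = 1" | "card V = 2" | "card V \<ge> 3"
    by linarith
  then have "card E + 3 \<le> 3 * card V \<and> (card V \<ge> 2 \<longrightarrow> card E + 5 \<le> 3 * card V)"
  proof cases
    case 1
    then show ?thesis
      using c by (simp add: choose_two)
  next
    case 2
    then show ?thesis
      using c by (simp add: choose_two)
  next
    case 3
    then have "card E + 6 \<le> 3 * card V"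
      using assms(2) by (simp add: edge_bounds_def)
    then show ?thesis
      by linarith
  qed
  then show "card E + 3 \<le> 3 * card V" "card V \<ge> 2 \<Longrightarrow> card E + 5 \<le> 3 * card V"
    by simp_all
qed

text \<open>Both bounds are additive up to a shared vertex. For the second one, disjoint parts
  contribute 3 + 3 = 6, and parts sharing a vertex contribute 5 + 5, of which the vertex counted
  twice consumes 3.\<close>

lemma edge_bounds_Un:
  assumes S: "simple_graph V1 E1" "simple_graph V2 E2"
    and B: "edge_bounds V1 E1" "edge_bounds V2 E2"
    and i: "card (V1 \<inter> V2) \<le> 1" "E1 \<inter> E2 = {}"
    and less: "card V1 < card (V1 \<union> V2)" "card V2 < card (V1 \<union> V2)"
  shows "edge_bounds (V1 \<union> V2) (E1 \<union> E2)"
proof -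
  note S1 = simple_graphD[OF S(1)] and S2 = simple_graphD[OF S(2)]
  have V: "card V1 + card V2 = card (V1 \<union> V2) + card (V1 \<inter> V2)"
    by (rule card_Un_Int[OF S1(1) S2(1)])
  have E: "card (E1 \<union> E2) = card E1 + card E2"
    by (rule card_Un_disjoint[OF S1(3) S2(3) i(2)])
  have "triangles E1 \<inter> triangles E2 = {}"
  proof (rule ccontr)
    assume "triangles E1 \<inter> triangles E2 \<noteq> {}"
    then obtain T where "card T = 3" "pairs T \<subseteq> E1 \<inter> E2"
      by (auto simp: triangles_def)
    then show False
      using i(2) card_pairs_3[of T] by simp
  qed
  then have "card (triangles E1 \<union> triangles E2) = card (triangles E1) + card (triangles E2)"
    by (rule card_Un_disjoint[OF S1(5) S2(5)])
  moreover have "finite (triangles (E1 \<union> E2))"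
  proof (rule finite_subset[OF triangles_subset])
    have "finite (\<Union>E1)" "finite (\<Union>E2)"
      by (rule finite_subset[OF S1(4) S1(1)], rule finite_subset[OF S2(4) S2(1)])
    then show "finite (Pow (\<Union>(E1 \<union> E2)))"
      by simp
  qed
  then have "card (triangles E1 \<union> triangles E2) \<le> card (triangles (E1 \<union> E2))"
    by (rule card_mono) (auto simp: triangles_def)
  ultimately have T: "card (triangles E1) + card (triangles E2) \<le> card (triangles (E1 \<union> E2))"
    by simp
  have "card V1 > 0" "card V2 > 0"
    using S1(1,2) S2(1,2) by (simp_all add: card_gt_0_iff)
  have "card (E1 \<union> E2) + 6 \<le> 3 * card (V1 \<union> V2)"
  proof (cases "card (V1 \<inter> V2) = 0")
    case True
    then show ?thesis
      using edge_bounds_small(1)[OF S(1) B(1)] edge_bounds_small(1)[OF S(2) B(2)] V E by linarith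
  next
    case False
    \<comment> \<open>With one shared vertex, a part of a single vertex would make the other part
      the whole, against \<open>less\<close>.\<close>
    then have "card V1 \<ge> 2" "card V2 \<ge> 2"
      using V i(1) less by linarith+
    then show ?thesis
      using edge_bounds_small(2)[OF S(1) B(1)] edge_bounds_small(2)[OF S(2) B(2)] V E i(1)
      by linarith
  qed
  moreover have "2 * card (E1 \<union> E2) + 4 \<le> 4 * card (V1 \<union> V2) + card (triangles (E1 \<union> E2))"
    using B V E T i(1) unfolding edge_bounds_def by linarith
  ultimately show ?thesis
    by (simp add: edge_bounds_def)
qed

lemma reachable_sym:
  assumes "reachable D x y"
  shows "reachable D y x"
  using assms
proof induction
  case (step y z)
  then show ?case
    by (metis (no_types, lifting) converse_rtranclp_into_rtranclp insert_commute)
qed simp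

section \<open>Edge bounds for plane drawings\<close>

context drawing
begin

lemma faces_bounds:
  assumes "faces H F D"
  shows "2 * card H + 7 \<le> 4 * card (\<Union>H) + card (triangles H)" "card H + 6 \<le> 3 * card (\<Union>H)"
proof -
  note FD = facesD[OF assms]
  have D: "card D \<ge> 3"
    by (rule cycleD(3)[OF FD(5)])
  have F3: "card C \<ge> 3" if "C \<in> F" for C
    by (rule cycleD(3)[OF FD(3)[OF that]])
  \<comment> \<open>Only bounded faces enter, so that distinct faces of length three give distinct
    triangles.\<close>
  let ?T = "{C \<in> F. card C = 3}"
  have "finite (triangles H)"
  proof (rule finite_subset)
    show "triangles H \<subseteq> Pow (\<Union>H)"
      by (rule triangles_subset)
    show "finite (Pow (\<Union>H))"
      using FD(13) by (simp only: finite_Pow_iff)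
  qed
  moreover have "inj_on Union ?T"
  proof (rule inj_onI)
    fix A B assume *: "A \<in> ?T" "B \<in> ?T" "\<Union>A = \<Union>B"
    then have c: "cycle A" "card A = 3" "cycle B" "card B = 3"
      using FD(3) by auto
    have "A = pairs (\<Union>A)" "B = pairs (\<Union>B)"
      by (rule cycle_3(2)[OF c(1,2)], rule cycle_3(2)[OF c(3,4)])
    then show "A = B"
      using *(3) by simp
  qed
  moreover have "Union ` ?T \<subseteq> triangles H"
  proof
    fix T assume "T \<in> Union ` ?T"
    then obtain C where C: "C \<in> F" "card C = 3" "T = \<Union>C"
      by blast
    then show "T \<in> triangles H"
      using cycle_3[OF FD(3)[OF C(1)] C(2)] FD(4)[OF C(1)] by (simp add: triangles_def)
  qed
  ultimately have T: "card ?T \<le> card (triangles H)"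
    by (intro card_inj_on_le)
  \<comment> \<open>A face of length three lacks one to reach length four; its triangle pays for
    it.\<close>
  have "(\<Sum>C\<in>F. 4) \<le> (\<Sum>C\<in>F. card C + (if card C = 3 then 1 else 0))"
    by (rule sum_mono) (use F3 in force)
  also have "\<dots> = (\<Sum>C\<in>F. card C) + card ?T"
    using FD(2) by (simp add: sum.distrib sum.If_cases Int_def)
  finally have "4 * card F \<le> (\<Sum>C\<in>F. card C) + card ?T"
    by simp
  then show "2 * card H + 7 \<le> 4 * card (\<Union>H) + card (triangles H)"
    using T D FD(10,11) by linarith
  have "(\<Sum>C\<in>F. 3) \<le> (\<Sum>C\<in>F. card C)"
    by (rule sum_mono) (rule F3)
  then have "3 * card F \<le> (\<Sum>C\<in>F. card C)"
    by simp
  then show "card H + 6 \<le> 3 * card (\<Union>H)"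
    using D FD(10,11) by linarith
qed

text \<open>A component of \<open>E - H\<close> that met \<open>H\<close> in two vertices would
  contain a path between them, hence an ear. So it can be split off at one vertex at most, and both
  parts are smaller than \<open>V\<close>.\<close>

lemma edge_bounds_no_ear:
  assumes IH: "\<And>V' E'. card V' < card V \<Longrightarrow> V' \<subseteq> V \<Longrightarrow> E' \<subseteq> E \<Longrightarrow> simple_graph V' E' \<Longrightarrow> edge_bounds V' E'"
    and H: "H \<subseteq> E" "H \<noteq> {}" and no_ear: "\<nexists>x y P. ear H x y P" and ne: "H \<noteq> E"
  shows "edge_bounds V E"
proof -
  obtain f where f: "f \<in> E - H"
    using H(1) ne by blast
  obtain a b where ab: "f = {a, b}" "a \<noteq> b"
    using card_edge[of f] f by (auto simp: card_2_iff)
  \<comment> \<open>The vertex set of the component of \<open>E - H\<close> that contains the chosen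
    edge outside \<open>H\<close>.\<close>
  define K where "K = {u. reachable (E - H) a u}"
  have "{a, b} \<in> E - H"
    using f ab by simp
  then have aK: "a \<in> K" "b \<in> K"
    by (auto simp: K_def)
  have closed: "e \<subseteq> K" if e: "e \<in> E - H" "e \<inter> K \<noteq> {}" for e
  proof -
    obtain u where u: "u \<in> e" "u \<in> K"
      using e(2) by blast
    obtain w where w: "e = {u, w}"
      using card_edge[of e] e(1) u(1) by (auto simp: card_2_iff)
    have "{u, w} \<in> E - H"
      using e(1) w by simp
    then have "w \<in> K"
      using u(2) unfolding K_def by (simp add: rtranclp.rtrancl_into_rtrancl)
    then show ?thesis
      using w u by simp
  qed
  have KV: "K \<subseteq> V"
  proof
    fix u assume "u \<in> K"
    then have "reachable (E - H) a u"
      by (simp add: K_def)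
    then show "u \<in> V"
    proof induction
      case base
      then show ?case
        using f ab edge_subset by blast
    next
      case (step y z)
      then show ?case
        using edge_subset[of "{y, z}"] by simp
    qed
  qed
  have one: "x = y" if xy: "x \<in> K \<inter> \<Union>H" "y \<in> K \<inter> \<Union>H" for x y
  proof (rule ccontr)
    assume "x \<noteq> y"
    have "reachable (E - H) x a" "reachable (E - H) a y"
      using xy reachable_sym[of "E - H" a x] by (simp_all add: K_def)
    then have "reachable (E - H) x y"
      by (rule rtranclp_trans)
    then obtain P where P: "P \<subseteq> E - H" "upath x y P"
      using reachable_imp_upath[of "E - H" x y] card_edge \<open>x \<noteq> y\<close> by blast
    obtain c d Q where "upath c d Q" "Q \<subseteq> P" "\<Union>Q \<inter> \<Union>H = {c, d}"
      using upath_ear[OF P(2), of "\<Union>H"] xy by blast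
    then have "ear H c d Q"
      using P(1) by (auto simp: ear_def)
    then show False
      using no_ear by blast
  qed
  have fK: "finite K"
    by (rule finite_subset[OF KV finite_V])
  have card_i: "card (K \<inter> \<Union>H) \<le> 1"
    using one fK by (auto simp: card_le_Suc0_iff_eq)
  \<comment> \<open>The remainder keeps the vertex of attachment, if there is one, and all edges
    other than those of the component.\<close>
  define V2 where "V2 = (V - K) \<union> (K \<inter> \<Union>H)"
  define E1 where "E1 = {e \<in> E - H. e \<subseteq> K}"
  have Un: "V = K \<union> V2" "E = E1 \<union> (E - E1)"
    using KV by (auto simp: V2_def E1_def)
  have int: "K \<inter> V2 = K \<inter> \<Union>H"
    by (auto simp: V2_def)
  obtain h where h: "h \<in> H"
    using H(2) by blast
  obtain c d where cd: "h = {c, d}" "c \<noteq> d"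
    using card_edge[OF subsetD[OF H(1) h]] by (auto simp: card_2_iff)
  have cdH: "c \<in> \<Union>H" "d \<in> \<Union>H"
    using h cd(1) by blast+
  have cdV: "c \<in> V" "d \<in> V"
    using Union_subset_V[OF H(1)] cdH by blast+
  \<comment> \<open>\<open>K\<close> contains at most one end of an edge of \<open>H\<close>, so it
    is not all of \<open>V\<close>. Dually, \<open>V2\<close> below misses an end of the edge
    outside \<open>H\<close>.\<close>
  have "\<not> (c \<in> K \<and> d \<in> K)"
    using one[of c d] cd(2) cdH by blast
  then have "K \<noteq> V"
    using cdV by blast
  then have KV': "card K < card V"
    using KV finite_V by (intro psubset_card_mono) auto
  have V2V: "V2 \<subseteq> V"
    using KV by (auto simp: V2_def)
  have "\<not> (a \<in> V2 \<and> b \<in> V2)"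
    using one[of a b] ab(2) aK by (auto simp: V2_def)
  then have "V2 \<noteq> V"
    using aK KV by blast
  then have V2V': "card V2 < card V"
    using V2V finite_V by (intro psubset_card_mono) auto
  have "V2 \<noteq> {}"
    using \<open>K \<noteq> V\<close> Un by blast
  moreover have "e \<subseteq> V2" if e: "e \<in> E - E1" for e
  proof (cases "e \<in> H")
    case True
    then have "e \<subseteq> \<Union>H" "e \<subseteq> V"
      using edge_subset H(1) by blast+
    then show ?thesis
      by (auto simp: V2_def)
  next
    case False
    then have "e \<inter> K = {}"
      using closed[of e] e by (auto simp: E1_def)
    moreover have "e \<subseteq> V"
      using edge_subset e by blast
    ultimately show ?thesis
      by (auto simp: V2_def)
  qed
  ultimately have S2: "simple_graph V2 (E - E1)"
    using V2V finite_V card_edge by (auto simp: simple_graph_def intro: finite_subset)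
  have S1: "simple_graph K E1"
    using fK aK card_edge by (auto simp: simple_graph_def E1_def)
  have "edge_bounds (K \<union> V2) (E1 \<union> (E - E1))"
  proof (rule edge_bounds_Un[OF S1 S2])
    show "edge_bounds K E1"
      using IH[OF KV' KV _ S1] by (auto simp: E1_def)
    show "edge_bounds V2 (E - E1)"
      using IH[OF V2V' V2V _ S2] by auto
  qed (use card_i int Un KV' V2V' in auto)
  then show ?thesis
    using Un by simp
qed

lemma edge_bounds_step:
  assumes IH: "\<And>V' E'. card V' < card V \<Longrightarrow> V' \<subseteq> V \<Longrightarrow> E' \<subseteq> E \<Longrightarrow> simple_graph V' E' \<Longrightarrow> edge_bounds V' E'"
  shows "edge_bounds V E"
proof (cases "E = {}")
  case True
  have "card V > 0"
    using simple_graphD(1,2)[OF simple] by (simp add: card_gt_0_iff)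
  then show ?thesis
    using True by (simp add: edge_bounds_def)
next
  case E0: False
  have VE: "\<Union>E \<subseteq> V"
    by (rule Union_subset_V) simp
  have "card (\<Union>E) \<le> card V"
    by (rule card_mono[OF finite_V VE])
  show ?thesis
  proof (cases "\<exists>C\<subseteq>E. cycle C")
    case True
    then obtain C where C: "C \<subseteq> E" "cycle C"
      by blast
    let ?P = "\<lambda>H. \<exists>F D. faces H F D"
    have "?P C"
      using faces_cycle[OF C(2,1)] by blast
    moreover have "\<forall>H. ?P H \<longrightarrow> card H < Suc (card E)"
      using facesD(1) card_mono[OF finite_E] by (auto simp: less_Suc_eq_le)
    \<comment> \<open>An edge-maximal subgraph with a face structure; by \<open>faces_ear\<close> it
      admits no further ear.\<close>
    ultimately obtain H where H: "?P H" and max: "\<forall>H'. ?P H' \<longrightarrow> card H' \<le> card H"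
      using ex_has_greatest_nat[of ?P C card "Suc (card E)"] by blast
    obtain F D where F: "faces H F D"
      using H by blast
    have no_ear: "\<nexists>x y P. ear H x y P"
    proof
      assume "\<exists>x y P. ear H x y P"
      then obtain x y P where e: "ear H x y P"
        by blast
      have "card P \<noteq> 0"
        using e upath_nonempty upathD(4) by (fastforce simp: ear_def)
      moreover have "card (H \<union> P) \<le> card H"
        using faces_ear[OF F e] max by blast
      ultimately show False
        using ear_count(1)[OF F e] by simp
    qed
    have "D \<noteq> {}"
      using cycleD(3)[OF facesD(5)[OF F]] by auto
    then have H0: "H \<noteq> {}"
      using facesD(6)[OF F] by blast
    show ?thesis
    proof (cases "H = E")
      case True
      then show ?thesis
        using faces_bounds[OF F] \<open>card (\<Union>E) \<le> card V\<close> by (simp add: edge_bounds_def)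
    next
      case False
      then show ?thesis
        using edge_bounds_no_ear[OF IH facesD(1)[OF F] H0 no_ear] by blast
    qed
  next
    case no_cycle: False
    obtain e where e: "e \<in> E"
      using E0 by blast
    \<comment> \<open>Without cycles a single edge plays the part of \<open>H\<close>: an ear would
      join its two ends and close up with it to a cycle.\<close>
    have no_ear: "\<nexists>x y P. ear {e} x y P"
    proof
      assume "\<exists>x y P. ear {e} x y P"
      then obtain x y P where P: "upath x y P" "P \<subseteq> E" "P \<inter> {e} = {}" "\<Union>P \<inter> e = {x, y}"
        by (auto simp: ear_def)
      have xy: "x \<noteq> y"
        by (rule upathD(3)[OF P(1)])
      have "{x, y} \<subseteq> e"
        using P(4) by auto
      then have "e = {x, y}"
        using card_edge[OF e] xy card_subset_eq[of e "{x, y}"] card_ge_0_finite[of e] by simp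
      then have "cycle_split x y P {e}"
        using P upath.edge[OF xy] by (simp add: cycle_split_def)
      then have "cycle (P \<union> {e})"
        unfolding cycle_def by (intro exI conjI) (assumption, rule refl)
      moreover have "P \<union> {e} \<subseteq> E"
        using P(2) e by simp
      ultimately show False
        using no_cycle by meson
    qed
    show ?thesis
    proof (cases "{e} = E")
      case True
      have "card e \<le> card V"
        using card_mono[OF finite_V edge_subset[OF e]] .
      then have "card E = 1" "card V \<ge> 2"
        using True card_edge[OF e] by auto
      then show ?thesis
        by (simp add: edge_bounds_def)
    next
      case False
      then show ?thesis
        using edge_bounds_no_ear[OF IH _ _ no_ear] e by blast
    qed
  qed
qed

end

lemma plane_drawing_subgraph:
  assumes "plane_drawing V E p \<gamma>" "V' \<subseteq> V" "E' \<subseteq> E" "simple_graph V' E'"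
  shows "plane_drawing V' E' p \<gamma>"
proof -
  have sub: "e \<in> E" "e \<subseteq> V'" if "e \<in> E'" for e
    using assms(3,4) that by (auto simp: simple_graph_def)
  have "path_image (\<gamma> e) \<inter> p ` V' = p ` e" if "e \<in> E'" for e
  proof -
    have "path_image (\<gamma> e) \<inter> p ` V = p ` e"
      using assms(1) sub(1)[OF that] by (simp add: plane_drawing_def)
    then show ?thesis
      using assms(2) sub(2)[OF that] by blast
  qed
  moreover have "inj_on p V'"
    using assms(1) inj_on_subset[OF _ assms(2)] by (auto simp: plane_drawing_def)
  ultimately show ?thesis
    using assms(1) sub(1) unfolding plane_drawing_def by simp
qed

text \<open>Induction on the number of vertices with one fixed drawing, which also draws every
  subgraph.\<close>

lemma planar_edge_bounds:
  assumes "simple_graph V E" "plane_drawing V E p \<gamma>"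
  shows "edge_bounds V E"
  using assms
proof (induction "card V" arbitrary: V E rule: less_induct)
  case less
  interpret drawing V E p \<gamma>
    using less.prems by unfold_locales
  show ?case
  proof (rule edge_bounds_step)
    fix V' E' assume *: "card V' < card V" "V' \<subseteq> V" "E' \<subseteq> E" "simple_graph V' E'"
    then have "plane_drawing V' E' p \<gamma>"
      using plane_drawing_subgraph less.prems(2) by blast
    then show "edge_bounds V' E'"
      using less.hyps * by blast
  qed
qed

subsection \<open>Triangles and degrees\<close>

lemma neighbourhoodD:
  assumes "simple_graph V E" "u \<in> neighbourhood E v"
  shows "{u, v} \<in> E" "u \<in> V" "v \<in> V" "u \<noteq> v"
proof -
  show e: "{u, v} \<in> E"
    using assms(2) by (simp add: neighbourhood_def)
  then show "u \<in> V" "v \<in> V" "u \<noteq> v"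
    using assms(1) by (fastforce simp: simple_graph_def)+
qed

lemma finite_neighbourhood: "simple_graph V E \<Longrightarrow> finite (neighbourhood E v)"
  using neighbourhoodD(2) simple_graphD(1) by (metis finite_subset subsetI)

lemma pairs_insert:
  assumes "v \<notin> e"
  shows "pairs (insert v e) = pairs e \<union> (\<lambda>u. {u, v}) ` e"
proof
  show "pairs (insert v e) \<subseteq> pairs e \<union> (\<lambda>u. {u, v}) ` e"
  proof
    fix f assume "f \<in> pairs (insert v e)"
    then have f: "f \<subseteq> insert v e" "card f = 2"
      by (auto simp: pairs_def)
    then obtain x y where "f = {x, y}" "x \<noteq> y"
      by (auto simp: card_2_iff)
    then show "f \<in> pairs e \<union> (\<lambda>u. {u, v}) ` e"
      using f by (cases "x = v"; cases "y = v") (auto simp: pairs_def insert_commute)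
  qed
  show "pairs e \<union> (\<lambda>u. {u, v}) ` e \<subseteq> pairs (insert v e)"
    using assms by (auto simp: pairs_def card_insert_if)
qed

lemma pairs_2:
  assumes "card e = 2"
  shows "pairs e = {e}"
proof -
  have "finite e"
    using assms by (intro card_ge_0_finite) simp
  then show ?thesis
    using assms card_subset_eq[of e] by (auto simp: pairs_def)
qed

lemma triangle_insert:
  assumes "simple_graph V E" "e \<in> induced_edges E (neighbourhood E v)"
  shows "v \<notin> e" "card e = 2" "insert v e \<in> triangles E"
proof -
  have e: "e \<in> E" "e \<subseteq> neighbourhood E v"
    using assms(2) by (auto simp: induced_edges_def)
  show c: "card e = 2"
    using assms(1) e(1) by (simp add: simple_graph_def)
  show v: "v \<notin> e"
    using e(2) neighbourhoodD(4)[OF assms(1)] by blast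
  have "finite e"
    using c by (intro card_ge_0_finite) simp
  then have "card (insert v e) = 3"
    using v c by simp
  then show "insert v e \<in> triangles E"
    using e pairs_insert[OF v] pairs_2[OF c] by (auto simp: triangles_def neighbourhood_def)
qed

text \<open>An edge between two neighbours of \<open>v\<close> is the side opposite to
  \<open>v\<close> in a triangle, and every triangle at \<open>v\<close> has such a side.\<close>

lemma nbhd_edge_count_triangles:
  assumes "simple_graph V E"
  shows "nbhd_edge_count E v = card {T \<in> triangles E. v \<in> T}"
proof -
  have "bij_betw (insert v) (induced_edges E (neighbourhood E v)) {T \<in> triangles E. v \<in> T}"
  proof (rule bij_betw_imageI)
    show "inj_on (insert v) (induced_edges E (neighbourhood E v))"
      using triangle_insert(1)[OF assms] by (auto intro!: inj_onI simp: insert_ident)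
    show "insert v ` induced_edges E (neighbourhood E v) = {T \<in> triangles E. v \<in> T}"
    proof
      show "insert v ` induced_edges E (neighbourhood E v) \<subseteq> {T \<in> triangles E. v \<in> T}"
        using triangle_insert(3)[OF assms] by blast
      show "{T \<in> triangles E. v \<in> T} \<subseteq> insert v ` induced_edges E (neighbourhood E v)"
      proof
        fix T assume "T \<in> {T \<in> triangles E. v \<in> T}"
        then have T: "card T = 3" "pairs T \<subseteq> E" "v \<in> T"
          by (auto simp: triangles_def)
        have ins: "T = insert v (T - {v})" "v \<notin> T - {v}"
          using T(3) by auto
        have c: "card (T - {v}) = 2"
          using T(1,3) by simp
        have "pairs T = pairs (T - {v}) \<union> (\<lambda>u. {u, v}) ` (T - {v})"
          using pairs_insert[OF ins(2)] ins(1) by simp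
        then have "T - {v} \<in> E" "(\<lambda>u. {u, v}) ` (T - {v}) \<subseteq> E"
          using T(2) pairs_2[OF c] by auto
        then have "T - {v} \<in> induced_edges E (neighbourhood E v)"
          by (auto simp: induced_edges_def neighbourhood_def)
        then show "T \<in> insert v ` induced_edges E (neighbourhood E v)"
          using ins(1) by blast
      qed
    qed
  qed
  then show ?thesis
    unfolding nbhd_edge_count_def by (rule bij_betw_same_card)
qed

text \<open>Double counting of incidences between vertices and triangles.\<close>

lemma sum_nbhd_edge_count:
  assumes "simple_graph V E"
  shows "(\<Sum>v\<in>V. nbhd_edge_count E v) = 3 * card (triangles E)"
proof -
  note S = simple_graphD[OF assms]
  have "card {v \<in> V. v \<in> T} = 3" if "T \<in> triangles E" for T
  proof -
    have "T \<subseteq> V"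
      using triangles_subset that S(4) by blast
    then have "{v \<in> V. v \<in> T} = T"
      by blast
    then show ?thesis
      using that by (simp add: triangles_def)
  qed
  then have "(\<Sum>v\<in>V. card {T \<in> triangles E. v \<in> T}) = 3 * card (triangles E)"
    by (intro sum_multicount S) blast
  then show ?thesis
    by (simp add: nbhd_edge_count_triangles[OF assms])
qed

lemma sum_degree:
  assumes "simple_graph V E"
  shows "(\<Sum>v\<in>V. card (neighbourhood E v)) = 2 * card E"
proof -
  note S = simple_graphD[OF assms]
  have deg: "card (neighbourhood E v) = card {e \<in> E. v \<in> e}" for v
  proof (rule bij_betw_same_card[of "\<lambda>u. {u, v}"], rule bij_betw_imageI)
    show "inj_on (\<lambda>u. {u, v}) (neighbourhood E v)"
      by (auto intro!: inj_onI simp: doubleton_eq_iff)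
    show "(\<lambda>u. {u, v}) ` neighbourhood E v = {e \<in> E. v \<in> e}"
    proof
      show "(\<lambda>u. {u, v}) ` neighbourhood E v \<subseteq> {e \<in> E. v \<in> e}"
        by (auto simp: neighbourhood_def)
      show "{e \<in> E. v \<in> e} \<subseteq> (\<lambda>u. {u, v}) ` neighbourhood E v"
      proof
        fix e assume e: "e \<in> {e \<in> E. v \<in> e}"
        then have "card e = 2"
          using assms by (simp add: simple_graph_def)
        then obtain u where "e = {u, v}"
          using e by (auto simp: card_2_iff)
        then show "e \<in> (\<lambda>u. {u, v}) ` neighbourhood E v"
          using e by (auto simp: neighbourhood_def)
      qed
    qed
  qed
  have "card {v \<in> V. v \<in> e} = 2" if "e \<in> E" for e
  proof -
    have "{v \<in> V. v \<in> e} = e" "card e = 2"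
      using assms that by (auto simp: simple_graph_def)
    then show ?thesis
      by simp
  qed
  then have "(\<Sum>v\<in>V. card {e \<in> E. v \<in> e}) = 2 * card E"
    by (intro sum_multicount S) blast
  then show ?thesis
    by (simp add: deg)
qed

text \<open>Six edges need at least four neighbours. With exactly four, these and \<open>v\<close>
  would form a complete graph on five vertices.\<close>

lemma degree_ge_5:
  assumes "simple_graph V E" "plane_drawing V E p \<gamma>" "v \<in> V" "nbhd_edge_count E v \<ge> 6"
  shows "card (neighbourhood E v) \<ge> 5"
proof (rule ccontr)
  assume "\<not> ?thesis"
  let ?N = "neighbourhood E v" and ?I = "induced_edges E (neighbourhood E v)"
  have fN: "finite ?N"
    by (rule finite_neighbourhood[OF assms(1)])
  have "?I \<subseteq> pairs ?N"
    using assms(1) by (auto simp: induced_edges_def pairs_def simple_graph_def)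
  moreover have fp: "finite (pairs ?N)"
    using fN by (simp add: pairs_def)
  ultimately have I: "card ?I \<le> card ?N choose 2"
    using card_mono card_pairs[OF fN] by metis
  have "card ?N = 4"
  proof (rule ccontr)
    assume "card ?N \<noteq> 4"
    then have "card ?N \<in> {0, 1, 2, 3}"
      using \<open>\<not> card ?N \<ge> 5\<close> by auto
    then have "card ?N choose 2 \<le> 3"
      by (auto simp: choose_two)
    then show False
      using I assms(4) by (simp add: nbhd_edge_count_def)
  qed
  have vN: "v \<notin> ?N"
    using neighbourhoodD(4)[OF assms(1)] by blast
  let ?V = "insert v ?N" and ?E = "?I \<union> (\<lambda>u. {u, v}) ` ?N"
  have sub: "?V \<subseteq> V" "?E \<subseteq> E"
    using assms(3) neighbourhoodD[OF assms(1)] by (auto simp: induced_edges_def)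
  have S: "simple_graph ?V ?E"
    using assms(1) fN vN sub(2) unfolding simple_graph_def
    by (auto simp: induced_edges_def card_insert_if)
  have c: "card ?V = 5"
    using vN fN \<open>card ?N = 4\<close> by simp
  have "inj_on (\<lambda>u. {u, v}) ?N"
    by (auto intro!: inj_onI simp: doubleton_eq_iff)
  then have "card ((\<lambda>u. {u, v}) ` ?N) = 4"
    using \<open>card ?N = 4\<close> by (simp add: card_image)
  moreover have "?I \<inter> (\<lambda>u. {u, v}) ` ?N = {}"
    using triangle_insert(1)[OF assms(1)] by blast
  moreover have "finite ?I"
    by (rule finite_subset[OF _ simple_graphD(3)[OF assms(1)]]) (auto simp: induced_edges_def)
  ultimately have "card ?E = card ?I + 4"
    using fN by (simp add: card_Un_disjoint)
  \<comment> \<open>Six edges among the neighbours and four at \<open>v\<close>; but 10 + 6 > 3 *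
    5.\<close>
  then have "card ?E \<ge> 10"
    using assms(4) by (simp add: nbhd_edge_count_def)
  moreover have "edge_bounds ?V ?E"
    using planar_edge_bounds[OF S plane_drawing_subgraph[OF assms(2) sub S]] .
  ultimately show False
    using c by (simp add: edge_bounds_def)
qed

section \<open>Vertices inside triangles\<close>

context drawing
begin

definition vertices_inside :: "'a set \<Rightarrow> 'a set" where
  "vertices_inside T = {v \<in> V. p v \<in> inside (img (pairs T))}"

lemma triangle_cases:
  assumes "T \<in> triangles E" "u \<in> T" "w \<in> T" "u \<noteq> w"
  obtains a where "T = {u, w, a}" "a \<noteq> u" "a \<noteq> w" "pairs T = {{u, w}, {u, a}, {a, w}}"
    "{u, w} \<in> E" "{u, a} \<in> E" "{a, w} \<in> E"
proof -
  have T: "card T = 3" "pairs T \<subseteq> E"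
    using assms(1) by (auto simp: triangles_def)
  then obtain x y z where xyz: "T = {x, y, z}" "x \<noteq> y" "x \<noteq> z" "y \<noteq> z"
    by (auto simp: card_3_iff)
  obtain a where a: "T = {u, w, a}" "a \<noteq> u" "a \<noteq> w"
    using xyz assms(2-4) by blast
  have "T = insert w (insert u {a})"
    using a(1) by auto
  then have "pairs T = pairs {u, a} \<union> (\<lambda>x. {x, w}) ` {u, a}"
    using pairs_insert[of w "{u, a}"] a assms(4) by simp
  moreover have "pairs {u, a} = {{u, a}}"
    using pairs_2[of "{u, a}"] a(2) by simp
  ultimately have P: "pairs T = {{u, w}, {u, a}, {a, w}}"
    by auto
  show ?thesis
    using that[OF a P] T(2) P by simp
qed

lemma triangle_arcs:
  assumes E: "{u, w} \<in> E" "{u, a} \<in> E" "{a, w} \<in> E" and ne: "u \<noteq> w" "a \<noteq> u" "a \<noteq> w"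
  shows "cycle_split u w {{u, w}} {{u, a}, {a, w}}"
    and "cycle {{u, w}, {u, a}, {a, w}}"
proof -
  have "upath u w {{u, a}, {a, w}}"
    using upath.step[OF upath.edge[of a w], of u] ne by simp
  moreover have "upath u w {{u, w}}"
    by (rule upath.edge[OF ne(1)])
  ultimately show *: "cycle_split u w {{u, w}} {{u, a}, {a, w}}"
    using ne by (auto simp: cycle_split_def doubleton_eq_iff)
  then show "cycle {{u, w}, {u, a}, {a, w}}"
    unfolding cycle_def by (metis insert_is_Un)
qed

lemma triangle_curve:
  assumes "T \<in> triangles E"
  shows "closed_curve (img (pairs T))"
proof -
  obtain u w where uw: "u \<in> T" "w \<in> T" "u \<noteq> w"
    using assms by (auto simp: triangles_def card_3_iff)
  then obtain a where a: "a \<noteq> u" "a \<noteq> w" "pairs T = {{u, w}, {u, a}, {a, w}}"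
    "{u, w} \<in> E" "{u, a} \<in> E" "{a, w} \<in> E"
    by (rule triangle_cases[OF assms])
  then show ?thesis
    using cycle_curve triangle_arcs(2)[OF a(4-6) uw(3) a(1,2)] by simp
qed

text \<open>Three common neighbours yield three arcs from \<open>u\<close> to \<open>w\<close>
  besides the edge itself. By \<open>four_arcs\<close> one of them enters a triangle formed by the
  edge and another arc, and so its middle vertex lies inside that triangle.\<close>

lemma common_neighbours_le_2:
  assumes uw: "{u, w} \<in> E" "u \<noteq> w"
    and empty: "\<And>T. T \<in> triangles E \<Longrightarrow> u \<in> T \<Longrightarrow> w \<in> T \<Longrightarrow> vertices_inside T = {}"
    and A: "A \<subseteq> {a. {u, a} \<in> E \<and> {a, w} \<in> E}"
  shows "card A \<le> 2"
proof (rule ccontr)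
  assume "\<not> card A \<le> 2"
  then obtain S where "S \<subseteq> A" "card S = 3"
    by (metis not_less_eq_eq numeral_2_eq_2 numeral_3_eq_3 obtain_subset_with_card_n)
  then obtain a b c where abc: "{a, b, c} \<subseteq> A" "a \<noteq> b" "a \<noteq> c" "b \<noteq> c"
    by (auto simp: card_3_iff)
  define Q where "Q x = {{u, x}, {x, w}}" for x
  let ?X = "\<lambda>x. img (Q x)" and ?e = "img {{u, w}}"
  have edges: "{u, x} \<in> E" "{x, w} \<in> E" if "x \<in> A" for x
    using A that by auto
  have ne: "x \<noteq> u" "x \<noteq> w" if "x \<in> A" for x
    using card_edge[OF edges(1)[OF that]] card_edge[OF edges(2)[OF that]] by (auto simp: card_insert_if)
  have sub: "Q x \<subseteq> E" "{{u, w}} \<subseteq> E" if "x \<in> A" for x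
    using edges[OF that] uw by (auto simp: Q_def)
  have cs: "cycle_split u w {{u, w}} (Q x)" if "x \<in> A" for x
    using triangle_arcs(1)[OF uw(1) edges[OF that] uw(2) ne[OF that]] by (simp add: Q_def)
  have arcX: "arc_between (p u) (p w) (?X x)" and arce: "arc_between (p u) (p w) ?e"
    and eX: "?e \<inter> ?X x = {p u, p w}" if "x \<in> A" for x
    using cycle_split_arcs[OF cs[OF that] sub(2)[OF that] sub(1)[OF that]] by auto
  have XX: "?X x \<inter> ?X y = {p u, p w}" if xy: "x \<in> A" "y \<in> A" "x \<noteq> y" for x y
  proof -
    have "Q x \<inter> Q y = {}" "\<Union>(Q x) \<inter> \<Union>(Q y) = {u, w}"
      using ne[OF xy(1)] ne[OF xy(2)] xy(3) by (auto simp: Q_def doubleton_eq_iff)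
    then show ?thesis
      using img_Int[OF sub(1)[OF xy(1)] sub(1)[OF xy(2)]] by simp
  qed
  have no: "?X x \<inter> inside (?e \<union> ?X y) = {}" if xy: "x \<in> A" "y \<in> A" "x \<noteq> y" for x y
  proof (rule ccontr)
    assume *: "?X x \<inter> inside (?e \<union> ?X y) \<noteq> {}"
    have K: "?X x \<inter> (?e \<union> ?X y) = {p u, p w}"
      using eX[OF xy(1)] XX[OF xy] by auto
    \<comment> \<open>The arc meets the triangle only in its ends, so once it enters the inside its
      whole interior is there, including \<open>p x\<close>.\<close>
    have "?X x - {p u, p w} \<subseteq> inside (?e \<union> ?X y)"
    proof (rule connected_subset_inside)
      show "connected (?X x - {p u, p w})"
        by (rule arc_betweenD(7)[OF arcX[OF xy(1)]])
      show "(?X x - {p u, p w}) \<inter> (?e \<union> ?X y) = {}"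
        using K by blast
      show "(?X x - {p u, p w}) \<inter> inside (?e \<union> ?X y) \<noteq> {}"
        using * K inside_no_overlap[of "?e \<union> ?X y"] by blast
    qed
    moreover have xV: "x \<in> V" "u \<in> V" "w \<in> V"
      using edge_subset[OF edges(1)[OF xy(1)]] edge_subset[OF uw(1)] by auto
    moreover have "p x \<in> ?X x"
      using vertex_in_img[OF sub(1)[OF xy(1)] xV(1)] by (simp add: Q_def)
    moreover have "p x \<noteq> p u" "p x \<noteq> p w"
      using inj_onD[OF inj_p] xV ne[OF xy(1)] by blast+
    ultimately have px: "p x \<in> inside (?e \<union> ?X y)"
      by blast
    let ?T = "{u, w, y}"
    have P: "pairs ?T = {{u, w}} \<union> Q y"
    proof -
      have "pairs (insert w {u, y}) = pairs {u, y} \<union> (\<lambda>x. {x, w}) ` {u, y}"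
        using ne[OF xy(2)] uw(2) by (intro pairs_insert) auto
      moreover have "pairs {u, y} = {{u, y}}"
        using pairs_2[of "{u, y}"] ne[OF xy(2)] by simp
      ultimately show ?thesis
        by (auto simp: Q_def insert_commute)
    qed
    have "card ?T = 3"
      using ne[OF xy(2)] uw(2) by simp
    then have "?T \<in> triangles E"
      using P sub[OF xy(2)] by (simp add: triangles_def)
    then have "vertices_inside ?T = {}"
      using empty by simp
    then show False
      using px xV(1) unfolding vertices_inside_def P img_Un by blast
  qed
  have m: "a \<in> A" "b \<in> A" "c \<in> A"
    using abc(1) by auto
  have "\<exists>X\<in>{?X a, ?X b, ?X c}. \<exists>Y\<in>{?X a, ?X b, ?X c}. X \<noteq> Y \<and> X \<inter> inside (?e \<union> Y) \<noteq> {}"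
    by (rule four_arcs[OF arce[OF m(1)] arcX[OF m(1)] arcX[OF m(2)] arcX[OF m(3)]
      XX[OF m(1,2) abc(2)] XX[OF m(1,3) abc(3)] XX[OF m(2,3) abc(4)] eX[OF m(1)] eX[OF m(2)] eX[OF m(3)]])
  then obtain x y where "x \<in> {a, b, c}" "y \<in> {a, b, c}" "?X x \<noteq> ?X y" "?X x \<inter> inside (?e \<union> ?X y) \<noteq> {}"
    by blast
  then show False
    using no[of x y] m by auto
qed

text \<open>Each edge counted by e(w) has two ends among the neighbours of \<open>w\<close>. Each
  neighbour \<open>u\<close> is an end of at most two such edges, because their other ends are
  common neighbours of \<open>u\<close> and \<open>w\<close>.\<close>

lemma nbhd_edge_count_le_degree:
  assumes "\<And>T. T \<in> triangles E \<Longrightarrow> w \<in> T \<Longrightarrow> vertices_inside T = {}"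
  shows "nbhd_edge_count E w \<le> card (neighbourhood E w)"
proof -
  let ?N = "neighbourhood E w" and ?I = "induced_edges E (neighbourhood E w)"
  have fI: "finite ?I"
    by (rule finite_subset[OF _ finite_E]) (auto simp: induced_edges_def)
  have fN: "finite ?N"
    by (rule finite_neighbourhood[OF simple])
  have "card {u \<in> ?N. u \<in> e} = 2" if "e \<in> ?I" for e
  proof -
    have "{u \<in> ?N. u \<in> e} = e" "card e = 2"
      using that card_edge by (auto simp: induced_edges_def)
    then show ?thesis
      by simp
  qed
  then have "2 * card ?I = (\<Sum>u\<in>?N. card {e \<in> ?I. u \<in> e})"
    by (intro sum_multicount[symmetric] fN fI) blast
  also have "\<dots> \<le> (\<Sum>u\<in>?N. 2)"
  proof (rule sum_mono)
    fix u assume u: "u \<in> ?N"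
    note uw = neighbourhoodD[OF simple u]
    have sub: "{e \<in> ?I. u \<in> e} \<subseteq> (\<lambda>a. {u, a}) ` {a \<in> ?N. {u, a} \<in> E}"
    proof
      fix e assume e: "e \<in> {e \<in> ?I. u \<in> e}"
      then have "card e = 2"
        using card_edge by (simp add: induced_edges_def)
      then obtain a where "e = {u, a}"
        using e by (auto simp: card_2_iff)
      then show "e \<in> (\<lambda>a. {u, a}) ` {a \<in> ?N. {u, a} \<in> E}"
        using e by (auto simp: induced_edges_def)
    qed
    have "card {e \<in> ?I. u \<in> e} \<le> card {a \<in> ?N. {u, a} \<in> E}"
      using card_mono[OF _ sub] card_image_le[of "{a \<in> ?N. {u, a} \<in> E}" "\<lambda>a. {u, a}"] fN by simp
    also have "\<dots> \<le> 2"
      by (rule common_neighbours_le_2[OF uw(1,4)]) (use assms in \<open>auto simp: neighbourhood_def\<close>)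
    finally show "card {e \<in> ?I. u \<in> e} \<le> 2" .
  qed
  finally show ?thesis
    by (simp add: nbhd_edge_count_def)
qed

text \<open>The triangle \<open>T'\<close> passes through a point inside \<open>T\<close> and cannot
  leave the closed region of \<open>T\<close>, so its inside is contained in that of
  \<open>T\<close>. The vertex \<open>w\<close> is lost, as it lies on \<open>T'\<close>
  itself.\<close>

lemma vertices_inside_psubset:
  assumes T: "T \<in> triangles E" and w: "w \<in> vertices_inside T"
    and T': "T' \<in> triangles E" "w \<in> T'"
  shows "vertices_inside T' \<subset> vertices_inside T"
proof -
  let ?K = "img (pairs T)" and ?K' = "img (pairs T')"
  have PT: "pairs T \<subseteq> E" "pairs T' \<subseteq> E" and cT: "card T = 3" "card T' = 3"
    using T T'(1) by (auto simp: triangles_def)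
  note cK = closed_curveD[OF triangle_curve[OF T]]
  \<comment> \<open>An edge starting at an inside vertex can meet the curve of \<open>T\<close> only
    in its other end. So its open arc, which comes close to \<open>p u\<close>, stays
    inside.\<close>
  have edge: "path_image (\<gamma> e) \<subseteq> ?K \<union> inside ?K"
    if e: "e \<in> E" "u \<in> e" "p u \<in> inside ?K" for e u
  proof -
    obtain x where x: "e = {u, x}" "x \<noteq> u"
      using card_edge[OF e(1)] e(2) by (auto simp: card_2_iff)
    have arc: "arc_between (p u) (p x) (path_image (\<gamma> e))"
      using img_edge e(1) x(1) by simp
    have uV: "u \<in> V" "x \<in> V"
      using edge_subset[OF e(1)] x(1) by auto
    have "p u \<notin> ?K"
      using e(3) inside_no_overlap[of ?K] by blast
    then have "u \<notin> \<Union>(pairs T)"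
      using vertex_in_img[OF PT(1) uV(1)] by simp
    then have "e \<notin> pairs T" "\<Union>{e} \<inter> \<Union>(pairs T) \<subseteq> {x}"
      using e(2) x(1) by auto
    then have "img {e} \<inter> ?K \<subseteq> {p x}"
      using img_Int[of "{e}" "pairs T"] e(1) PT(1) by auto
    then have i: "path_image (\<gamma> e) \<inter> ?K \<subseteq> {p x}"
      by (simp add: img_def)
    let ?S = "path_image (\<gamma> e) - {p u, p x}"
    have S: "connected ?S" "?S \<inter> ?K = {}" "closure ?S = path_image (\<gamma> e)"
      using arc_betweenD[OF arc] i by auto
    have "open (inside ?K)"
      by (rule cK(4))
    moreover have "p u \<in> closure ?S"
      using S(3) arc_betweenD(1)[OF arc] by simp
    ultimately have "inside ?K \<inter> ?S \<noteq> {}"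
      using e(3) open_Int_closure_eq_empty[of "inside ?K" ?S] by blast
    then have "?S \<subseteq> inside ?K"
      using connected_subset_inside[OF S(1,2)] by blast
    then have "path_image (\<gamma> e) \<subseteq> closure (inside ?K)"
      using closure_mono S(3) by metis
    then show ?thesis
      using closure_inside_subset[OF cK(1)] by blast
  qed
  have wI: "w \<in> V" "p w \<in> inside ?K"
    using w by (auto simp: vertices_inside_def)
  obtain u where u: "u \<in> T'" "u \<noteq> w"
  proof -
    have "T' \<noteq> {w}"
      using cT(2) by auto
    then show ?thesis
      using that T'(2) by blast
  qed
  obtain a where a: "a \<noteq> u" "a \<noteq> w" "pairs T' = {{u, w}, {u, a}, {a, w}}"
    "{u, w} \<in> E" "{u, a} \<in> E" "{a, w} \<in> E"
    by (rule triangle_cases[OF T'(1) u(1) T'(2) u(2)])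
  have e1: "path_image (\<gamma> {u, w}) \<subseteq> ?K \<union> inside ?K" "path_image (\<gamma> {a, w}) \<subseteq> ?K \<union> inside ?K"
    using edge[of _ w] a(4,6) wI(2) by auto
  have uaV: "u \<in> V" "a \<in> V"
    using edge_subset[OF a(5)] by auto
  have "p u \<in> path_image (\<gamma> {u, w})" "p a \<in> path_image (\<gamma> {a, w})"
    using edge_Int_V[OF a(4)] edge_Int_V[OF a(6)] by auto
  then have pua: "p u \<in> ?K \<union> inside ?K" "p a \<in> ?K \<union> inside ?K"
    using e1 by blast+
  \<comment> \<open>The side opposite to \<open>w\<close> either has an end inside \<open>T\<close>,
    or joins two corners of \<open>T\<close> and is then a side of \<open>T\<close>.\<close>
  have "path_image (\<gamma> {u, a}) \<subseteq> ?K \<union> inside ?K"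
  proof (cases "p u \<in> inside ?K \<or> p a \<in> inside ?K")
    case True
    then show ?thesis
      using edge[of "{u, a}"] a(5) by blast
  next
    case False
    then have "u \<in> T" "a \<in> T"
      using pua vertex_in_img[OF PT(1)] uaV Union_pairs[OF cT(1)] by blast+
    then have "{u, a} \<in> pairs T"
      using a(1) by (simp add: pairs_def)
    then show ?thesis
      by (auto simp: img_def)
  qed
  then have K': "?K' \<subseteq> ?K \<union> inside ?K"
    using e1 a(3) by (simp add: img_def)
  \<comment> \<open>The outside of \<open>T\<close> is connected and avoids \<open>T'\<close>. Being
    unbounded, it cannot lie in the inside of \<open>T'\<close>.\<close>
  have "outside ?K \<subseteq> outside ?K'"
  proof -
    have "outside ?K \<inter> ?K' = {}"
      using K' union_with_inside[of ?K] by blast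
    moreover have "bounded (inside ?K')"
      by (rule closed_curveD(11)[OF triangle_curve[OF T'(1)]])
    then have "\<not> outside ?K \<subseteq> inside ?K'"
      using cK(9) bounded_subset by blast
    ultimately show ?thesis
      using connected_subset_inside[OF cK(8)] connected_subset_outside[OF cK(8)]
        inside_Un_outside[of ?K'] by blast
  qed
  then have "inside ?K' \<inter> outside ?K = {}"
    using inside_Int_outside[of ?K'] by blast
  \<comment> \<open>An open set that avoids the outside of \<open>T\<close> avoids its closure too,
    and thus the curve of \<open>T\<close>.\<close>
  moreover have "?K \<subseteq> closure (outside ?K)"
    using cK(10) by (auto simp: frontier_def)
  moreover have "open (inside ?K')"
    by (rule closed_curveD(4)[OF triangle_curve[OF T'(1)]])
  ultimately have "inside ?K' \<inter> ?K = {}" "inside ?K' \<inter> outside ?K = {}"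
    using open_Int_closure_eq_empty[of "inside ?K'" "outside ?K"] by blast+
  then have "inside ?K' \<subseteq> inside ?K"
    using union_with_inside[of ?K] by blast
  then have "vertices_inside T' \<subseteq> vertices_inside T"
    by (auto simp: vertices_inside_def)
  moreover have "p w \<in> ?K'"
    using vertex_in_img[OF PT(2) wI(1)] Union_pairs[OF cT(2)] T'(2) by simp
  then have "w \<notin> vertices_inside T'"
    using inside_no_overlap[of ?K'] unfolding vertices_inside_def by blast
  ultimately show ?thesis
    using w by blast
qed

text \<open>Otherwise every vertex would be on a triangle with vertices inside it. Passing from such
  a triangle to one through a vertex inside would give an infinite descent.\<close>

lemma ex_nbhd_edge_count_le_degree:
  "\<exists>w\<in>V. nbhd_edge_count E w \<le> card (neighbourhood E w)"
proof (rule ccontr)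
  assume "\<not> ?thesis"
  then have ex: "\<exists>T\<in>triangles E. w \<in> T \<and> vertices_inside T \<noteq> {}" if "w \<in> V" for w
    using nbhd_edge_count_le_degree[of w] that by (meson linorder_not_le)
  have "\<not> (T \<in> triangles E \<and> vertices_inside T \<noteq> {})" for T
  proof (induction "card (vertices_inside T)" arbitrary: T rule: less_induct)
    case less
    show ?case
    proof
      assume *: "T \<in> triangles E \<and> vertices_inside T \<noteq> {}"
      then obtain w where w: "w \<in> vertices_inside T"
        by blast
      then have "w \<in> V"
        by (simp add: vertices_inside_def)
      then obtain T' where T': "T' \<in> triangles E" "w \<in> T'" "vertices_inside T' \<noteq> {}"
        using ex by blast
      have "finite (vertices_inside T)"
        using finite_V by (simp add: vertices_inside_def)
      then have "card (vertices_inside T') < card (vertices_inside T)"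
        using vertices_inside_psubset[OF _ w T'(1,2)] * by (intro psubset_card_mono) auto
      then show False
        using less.hyps T' by blast
    qed
  qed
  moreover obtain v where "v \<in> V"
    using simple_graphD(2)[OF simple] by blast
  ultimately show False
    using ex by blast
qed

end

theorem theorem2p1:
  fixes V :: "'a set" and E :: "'a set set"
  assumes "simple_graph V E" and "planar V E"
  shows "\<not> (average_degree V E \<ge> 4 \<and> (\<forall>v\<in>V. nbhd_edge_count E v = 0)) \<and>
         \<not> (average_degree V E = 5 \<and>
              (\<exists>c\<in>{1, 2, 3}. \<forall>v\<in>V. nbhd_edge_count E v = c)) \<and>
         \<not> (average_degree V E \<le> 5 \<and> (\<forall>v\<in>V. nbhd_edge_count E v = 6))"
proof -
  obtain p \<gamma> where d: "plane_drawing V E p \<gamma>"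
    using assms(2) by (auto simp: planar_def)
  interpret drawing V E p \<gamma>
    using assms(1) d by unfold_locales
  note S = simple_graphD[OF assms(1)]
  have V: "card V > 0"
    using S(1,2) by (simp add: card_gt_0_iff)
  have bound: "2 * card E + 4 \<le> 4 * card V + card (triangles E)"
    using planar_edge_bounds[OF assms(1) d] by (simp add: edge_bounds_def)
  have tri: "3 * card (triangles E) = c * card V" if "\<forall>v\<in>V. nbhd_edge_count E v = c" for c
    using sum_nbhd_edge_count[OF assms(1)] that by (simp add: mult.commute)
  have i: "\<not> (average_degree V E \<ge> 4 \<and> (\<forall>v\<in>V. nbhd_edge_count E v = 0))"
  proof
    assume *: "average_degree V E \<ge> 4 \<and> (\<forall>v\<in>V. nbhd_edge_count E v = 0)"
    then have "4 * real (card V) \<le> 2 * real (card E)"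
      using V by (simp add: average_degree_def field_simps)
    moreover have "card (triangles E) = 0"
      using tri[of 0] * by simp
    ultimately show False
      using bound by linarith
  qed
  have ii: "\<not> (average_degree V E = 5 \<and> (\<exists>c\<in>{1, 2, 3}. \<forall>v\<in>V. nbhd_edge_count E v = c))"
  proof
    assume *: "average_degree V E = 5 \<and> (\<exists>c\<in>{1, 2, 3}. \<forall>v\<in>V. nbhd_edge_count E v = c)"
    then obtain c where "c \<in> {1, 2, 3}" "\<forall>v\<in>V. nbhd_edge_count E v = c"
      by blast
    then have c: "c \<le> 3" "3 * card (triangles E) = c * card V"
      using tri by auto
    have "2 * real (card E) = 5 * real (card V)"
      using * V by (simp add: average_degree_def field_simps)
    then have "2 * card E = 5 * card V"
      by linarith
    \<comment> \<open>So t \<le> n, and the bound would give 5n + 4 \<le> 4n + n.\<close>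
    moreover have "c * card V \<le> 3 * card V"
      using c(1) by simp
    ultimately show False
      using bound c(2) by linarith
  qed
  have iii: "\<not> (average_degree V E \<le> 5 \<and> (\<forall>v\<in>V. nbhd_edge_count E v = 6))"
  proof
    assume *: "average_degree V E \<le> 5 \<and> (\<forall>v\<in>V. nbhd_edge_count E v = 6)"
    have deg: "card (neighbourhood E v) \<ge> 5" if "v \<in> V" for v
      using degree_ge_5[OF assms(1) d that] * that by simp
    obtain w where w: "w \<in> V" "card (neighbourhood E w) \<ge> 6"
      using ex_nbhd_edge_count_le_degree * by auto
    \<comment> \<open>All degrees are at least 5, and the one at \<open>w\<close> makes the
      inequality strict.\<close>
    have "(\<Sum>v\<in>V. 5) < (\<Sum>v\<in>V. card (neighbourhood E v))"
      using w deg by (intro sum_strict_mono_ex1 S(1)) (auto intro!: bexI[of _ w])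
    then have "5 * card V < 2 * card E"
      using sum_degree[OF assms(1)] by simp
    moreover have "2 * real (card E) \<le> 5 * real (card V)"
      using * V by (simp add: average_degree_def field_simps)
    ultimately show False
      by linarith
  qed
  show ?thesis
    using i ii iii by blast
qed

end
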